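(* Let $n,a,b$ be integers with $n\ge a>b+1\ge 1$ and put $k=a-b$. Let $X$ and $Y$ be $n\times n$ matrices of the shape described in the context ($X$ supported in rows $1,\dots,a$ and columns $b+1,\dots,n$; $Y$ invertible with zero block in rows $a+1,\dots,n$ and columns $1,\dots,b$). Let $\varphi_1,\varphi_2,\varphi_{n+1}$ be the trailing minors of the core $\Phi$, let $c_i(X,Y)$, $0\le i\le k$, be the polynomials defined by $\det(\lambda Y+\mu X)=\lambda^{n-k}\sum_{i=0}^k c_i(X,Y)\mu^i\lambda^{k-i}$, and let $\bar Y=Y_{[2,n]}^{[2,n]}$. Then $$\varphi_1\varphi_1^*=\sum_{i=0}^k c_i(X,Y)\left((-1)^{n-1}\det\bar Y\,\varphi_{n+1}\right)^i\varphi_2^{\,k-i},$$ where $\varphi_1^*$ is a polynomial in the entries of $X$ and $Y$. (That is, the right-hand side is divisible by $\varphi_1$ in the ring of polynomials in the free entries of $X$ and $Y$.)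
   Context: Notation: $[p,q]=\{p,p+1,\dots,q\}$; $A_I^J$ is the submatrix of $A$ with rows $I$ and columns $J$; if an index set is omitted, all rows (or columns) are taken. Shapes: $X=\begin{bmatrix}0_{a\times b}&\ast\\ 0&0\end{bmatrix}\in\mathrm{Mat}_n(\mathbb C)$, where $\ast$ is $a\times(n-b)$, and $Y=\begin{bmatrix}\ast&\ast\\ 0_{(n-a)\times b}&\ast\end{bmatrix}\in GL_n(\mathbb C)$, where the upper left block is $a\times b$. Entries marked $\ast$ take arbitrary complex values; they are the free entries, treated as independent variables when speaking of polynomials. Core: $\Phi$ is the $((k-1)n+b)\times((k-1)n+b)$ matrix with $k$ block rows, with $k-1$ block columns of width $n$ followed by one block column of width $b$ (absent if $b=0$): $$\Phi=\begin{bmatrix} Y_{[2,n]}&&&&\\ X_{[2,n]}&Y_{[2,n]}&&&\\ &\ddots&\ddots&&\\ &&X_{[2,n]}&Y_{[2,n]}&\\ &&&X_{[2,a]}&Y_{[2,a]}^{[1,b]}\end{bmatrix},$$ where $Y_{[2,n]}$ occurs $k-1$ times and all blocks not shown are zero. For $1\le i\le (k-1)n+b$ set $\varphi_i=\det\Phi_{[i,(k-1)n+b]}^{[i,(k-1)n+b]}$, and set $\varphi_{(k-1)n+b+1}=1$. The polynomial $\det(\lambda Y+\mu X)$ is divisible by $\lambda^{n-k}$, so the $c_i(X,Y)$ are well-defined polynomials in the free entries. *)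

theory Defs
  imports
    "Jordan_Normal_Form.Determinant"
    "Jordan_Normal_Form.DL_Submatrix"
    "HOL-Library.Poly_Mapping"
begin

(* Matrix rows and columns are numbered from 0, as in Jordan_Normal_Form: row p of the
   mathematical text is row p - 1 here, and the index interval [p,q] becomes {p - 1..<q}. *)

section \<open>Shapes and the core\<close>

definition X_shape :: "nat \<Rightarrow> nat \<Rightarrow> nat \<Rightarrow> 'r :: zero mat \<Rightarrow> bool" where
  "X_shape n a b X \<longleftrightarrow> X \<in> carrier_mat n n \<and>
     (\<forall>i<n. \<forall>j<n. (i \<ge> a \<or> j < b) \<longrightarrow> X $$ (i, j) = 0)"

(* Invertibility of Y is kept separate, since the matrix of indeterminates also has this shape. *)
definition Y_shape :: "nat \<Rightarrow> nat \<Rightarrow> nat \<Rightarrow> 'r :: zero mat \<Rightarrow> bool" where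
  "Y_shape n a b Y \<longleftrightarrow> Y \<in> carrier_mat n n \<and>
     (\<forall>i<n. \<forall>j<n. (i \<ge> a \<and> j < b) \<longrightarrow> Y $$ (i, j) = 0)"

definition core_size :: "nat \<Rightarrow> nat \<Rightarrow> nat \<Rightarrow> nat" where
  "core_size n a b = (a - b - 1) * n + b"

(* Every block row consists of n - 1 rows and every block column of n columns, except that the
   last block row has only a - 1 rows and the last block column only b columns.  So row r lies in
   block row r div (n - 1) and comes from row r mod (n - 1) + 1 of X or Y (row 0 is
   dropped), and column c lies in block column c div n and comes from column c mod n.
   The truncations X_[2,a] and Y_[2,a]^[1,b] in the last block row are effected by the size. *)
definition core :: "nat \<Rightarrow> nat \<Rightarrow> nat \<Rightarrow> 'r :: zero mat \<Rightarrow> 'r mat \<Rightarrow> 'r mat" where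
  "core n a b X Y = mat (core_size n a b) (core_size n a b) (\<lambda>(r, c).
     if c div n = r div (n - 1) then Y $$ (r mod (n - 1) + 1, c mod n)
     else if c div n + 1 = r div (n - 1) then X $$ (r mod (n - 1) + 1, c mod n)
     else 0)"

(* The index i of the trailing minor is 1-based.  For i = core_size n a b + 1 the submatrix is
   empty and the minor is 1. *)
definition phi :: "nat \<Rightarrow> nat \<Rightarrow> nat \<Rightarrow> 'r :: comm_ring_1 mat \<Rightarrow> 'r mat \<Rightarrow> nat \<Rightarrow> 'r" where
  "phi n a b X Y i =
     det (submatrix (core n a b X Y) {i - 1..<core_size n a b} {i - 1..<core_size n a b})"

lemma phi_last: "phi n a b X Y (core_size n a b + 1) = 1"
  by (simp add: phi_def submatrix_def)

definition Y_bar :: "nat \<Rightarrow> 'r mat \<Rightarrow> 'r mat" where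
  "Y_bar n Y = submatrix Y {1..<n} {1..<n}"

section \<open>The pencil\<close>

(* Polynomials in lambda and mu are elements of R[lambda][mu]. *)
definition lam :: "'r :: comm_ring_1 poly poly" where
  "lam = [:[:0, 1:]:]"

definition mu :: "'r :: comm_ring_1 poly poly" where
  "mu = [:0, 1:]"

definition cnst :: "'r :: comm_ring_1 \<Rightarrow> 'r poly poly" where
  "cnst x = [:[:x:]:]"

definition pencil :: "'r :: comm_ring_1 mat \<Rightarrow> 'r mat \<Rightarrow> 'r poly poly mat" where
  "pencil X Y = lam \<cdot>\<^sub>m map_mat cnst Y + mu \<cdot>\<^sub>m map_mat cnst X"

definition pencil_coeffs ::
    "nat \<Rightarrow> nat \<Rightarrow> 'r :: comm_ring_1 mat \<Rightarrow> 'r mat \<Rightarrow> (nat \<Rightarrow> 'r) \<Rightarrow> bool" where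
  "pencil_coeffs n k X Y c \<longleftrightarrow>
     det (pencil X Y) = lam ^ (n - k) * (\<Sum>i=0..k. cnst (c i) * mu ^ i * lam ^ (k - i))"

section \<open>Polynomials in the free entries\<close>

(* X_ent i j and Y_ent i j are the indeterminates standing for the entries of X and Y. *)
datatype entry = X_ent nat nat | Y_ent nat nat

type_synonym entry_poly = "(entry \<Rightarrow>\<^sub>0 nat) \<Rightarrow>\<^sub>0 complex"

definition indet :: "entry \<Rightarrow> entry_poly" where
  "indet v = Poly_Mapping.single (Poly_Mapping.single v 1) 1"

definition free_entries :: "nat \<Rightarrow> nat \<Rightarrow> nat \<Rightarrow> entry set" where
  "free_entries n a b =
     {X_ent i j | i j. i < a \<and> b \<le> j \<and> j < n} \<union>
     {Y_ent i j | i j. i < n \<and> j < n \<and> \<not> (i \<ge> a \<and> j < b)}"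

definition generic_X :: "nat \<Rightarrow> nat \<Rightarrow> nat \<Rightarrow> entry_poly mat" where
  "generic_X n a b = mat n n (\<lambda>(i, j).
     if X_ent i j \<in> free_entries n a b then indet (X_ent i j) else 0)"

definition generic_Y :: "nat \<Rightarrow> nat \<Rightarrow> nat \<Rightarrow> entry_poly mat" where
  "generic_Y n a b = mat n n (\<lambda>(i, j).
     if Y_ent i j \<in> free_entries n a b then indet (Y_ent i j) else 0)"

definition polynomial_in :: "entry set \<Rightarrow> entry_poly \<Rightarrow> bool" where
  "polynomial_in V p \<longleftrightarrow> (\<forall>m\<in>Poly_Mapping.keys p. Poly_Mapping.keys m \<subseteq> V)"

definition entry_value :: "complex mat \<Rightarrow> complex mat \<Rightarrow> entry \<Rightarrow> complex" where
  "entry_value X Y v = (case v of X_ent i j \<Rightarrow> X $$ (i, j) | Y_ent i j \<Rightarrow> Y $$ (i, j))"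

definition eval_at :: "complex mat \<Rightarrow> complex mat \<Rightarrow> entry_poly \<Rightarrow> complex" where
  "eval_at X Y p = (\<Sum>m\<in>Poly_Mapping.keys p. Poly_Mapping.lookup p m *
     (\<Prod>v\<in>Poly_Mapping.keys m. entry_value X Y v ^ Poly_Mapping.lookup m v))"

lemma generic_X_shape: "X_shape n a b (generic_X n a b)"
  by (auto simp: X_shape_def generic_X_def free_entries_def)

lemma generic_Y_shape: "Y_shape n a b (generic_Y n a b)"
  by (auto simp: Y_shape_def generic_Y_def free_entries_def)

section \<open>The pencil coefficients are well defined\<close>

lemma cnst_simps [simp]:
  "cnst 0 = 0" "cnst 1 = 1" "cnst (x + y) = cnst x + cnst y" "cnst (x * y) = cnst x * cnst y"
  by (simp_all add: cnst_def one_pCons)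

lemma cnst_sum: "cnst (sum f A) = (\<Sum>i\<in>A. cnst (f i))"
  by (induction A rule: infinite_finite_induct) auto

lemma cnst_prod: "cnst (prod f A) = (\<Prod>i\<in>A. cnst (f i))"
  by (induction A rule: infinite_finite_induct) auto

lemma coeff_pencil_form:
  assumes "i \<le> k"
  shows "coeff (coeff (lam ^ m * (\<Sum>i=0..k. cnst (c i) * mu ^ i * lam ^ (k - i))) i) (m + (k - i))
         = c i"
proof -
  have lam_pow: "lam ^ d = [:monom 1 d:]" for d
    by (induction d) (simp_all add: lam_def monom_0 monom_Suc one_pCons)
  have mu_pow: "mu ^ d = monom 1 d" for d
    by (induction d) (simp_all add: mu_def monom_0 monom_Suc flip: one_pCons)
  have monomial: "lam ^ m * (cnst (c j) * mu ^ j * lam ^ (k - j)) =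
      monom (monom (c j) (m + (k - j))) j" for j
    by (simp add: lam_pow mu_pow cnst_def smult_monom mult_monom)
  have "coeff (coeff (lam ^ m * (\<Sum>i=0..k. cnst (c i) * mu ^ i * lam ^ (k - i))) i) (m + (k - i))
      = (\<Sum>j=0..k. if j = i then c j else 0)"
    unfolding sum_distrib_left monomial coeff_sum by (intro sum.cong) auto
  then show ?thesis using assms by simp
qed

lemma pencil_coeffs_unique:
  assumes "pencil_coeffs n k X Y c" "pencil_coeffs n k X Y d" "i \<le> k"
  shows "c i = d i"
  using assms coeff_pencil_form[OF assms(3), of "n - k" c]
    coeff_pencil_form[OF assms(3), of "n - k" d]
  by (simp add: pencil_coeffs_def)

lemma prod_linear_forms:
  assumes "finite T"
  shows "\<exists>c. (\<Prod>i\<in>T. lam * cnst (y i) + mu * cnst (x i)) =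
           (\<Sum>i=0..card T. cnst (c i) * mu ^ i * lam ^ (card T - i))"
  using assms
proof (induction T rule: finite_induct)
  case empty
  show ?case by (rule exI[of _ "\<lambda>_. 1"]) simp
next
  case (insert t T)
  then obtain c where c: "(\<Prod>i\<in>T. lam * cnst (y i) + mu * cnst (x i)) =
      (\<Sum>i=0..card T. cnst (c i) * mu ^ i * lam ^ (card T - i))" by blast
  let ?m = "card T"
  define d where "d i = (if i \<le> ?m then y t * c i else 0) + (if i = 0 then 0 else x t * c (i - 1))"
    for i
  have "(\<Sum>i=0..Suc ?m. cnst (d i) * mu ^ i * lam ^ (Suc ?m - i)) =
     (\<Sum>i=0..Suc ?m. cnst (if i \<le> ?m then y t * c i else 0) * mu ^ i * lam ^ (Suc ?m - i)) +
     (\<Sum>i=0..Suc ?m. cnst (if i = 0 then 0 else x t * c (i - 1)) * mu ^ i * lam ^ (Suc ?m - i))"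
    by (simp only: d_def cnst_simps distrib_right sum.distrib)
  also have "(\<Sum>i=0..Suc ?m. cnst (if i \<le> ?m then y t * c i else 0) * mu ^ i * lam ^ (Suc ?m - i))
     = (\<Sum>i=0..?m. lam * cnst (y t) * (cnst (c i) * mu ^ i * lam ^ (?m - i)))"
    by (simp, rule sum.cong) (auto simp: Suc_diff_le algebra_simps)
  also have "(\<Sum>i=0..Suc ?m. cnst (if i = 0 then 0 else x t * c (i - 1)) * mu ^ i * lam ^ (Suc ?m - i))
     = (\<Sum>i=0..?m. mu * cnst (x t) * (cnst (c i) * mu ^ i * lam ^ (?m - i)))"
    by (subst sum.atLeast0_atMost_Suc_shift) (auto intro!: sum.cong simp: algebra_simps)
  finally have "(\<Sum>i=0..Suc ?m. cnst (d i) * mu ^ i * lam ^ (Suc ?m - i)) =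
      (lam * cnst (y t) + mu * cnst (x t)) *
      (\<Sum>i=0..?m. cnst (c i) * mu ^ i * lam ^ (?m - i))"
    by (simp only: sum_distrib_left[symmetric] distrib_right)
  moreover have "card (insert t T) = Suc ?m" using insert.hyps by simp
  moreover have "(\<Prod>i\<in>insert t T. lam * cnst (y i) + mu * cnst (x i)) =
      (lam * cnst (y t) + mu * cnst (x t)) *
      (\<Sum>i=0..?m. cnst (c i) * mu ^ i * lam ^ (?m - i))"
    using insert.hyps c by simp
  ultimately show ?case by (intro exI[of _ d]) (simp only:)
qed

lemma pencil_coeffs_exist:
  fixes X Y :: "'r :: comm_ring_1 mat"
  assumes X: "X_shape n a b X" and Y: "Y_shape n a b Y" and "b \<le> a" "a \<le> n"
  shows "\<exists>c. pencil_coeffs n (a - b) X Y c"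
proof -
  let ?k = "a - b"
  let ?F = "\<lambda>c. lam ^ (n - ?k) * (\<Sum>i=0..?k. cnst (c i) * mu ^ i * lam ^ (?k - i))"
  have dims: "X \<in> carrier_mat n n" "Y \<in> carrier_mat n n"
    using X Y by (auto simp: X_shape_def Y_shape_def)
  have car: "pencil X Y \<in> carrier_mat n n"
    using dims by (simp add: pencil_def)
  have ent: "pencil X Y $$ (i, j) = lam * cnst (Y $$ (i, j)) + mu * cnst (X $$ (i, j))"
    if "i < n" "j < n" for i j
    using dims that by (simp add: pencil_def)
  have ex: "\<exists>c. (\<Prod>i = 0..<n. pencil X Y $$ (i, p i)) = ?F c" if p: "p permutes {0..<n}" for p
  proof -
    have pn: "p i < n" if "i < n" for i
      using permutes_in_image[OF p, of i] that by simp
    define S where "S = {i. i < n \<and> (i \<ge> a \<or> p i < b)}"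
    define T where "T = {0..<n} - S"
    show ?thesis
    proof (cases "\<exists>i<n. i \<ge> a \<and> p i < b")
      case True
      then obtain i where i: "i < n" "i \<ge> a" "p i < b" by blast
      have "pencil X Y $$ (i, p i) = 0"
        using X Y i pn[OF i(1)] ent[OF i(1) pn[OF i(1)]] by (simp add: X_shape_def Y_shape_def)
      then have "(\<Prod>i = 0..<n. pencil X Y $$ (i, p i)) = 0"
        using i(1) by (intro prod_zero) auto
      then show ?thesis by (intro exI[of _ "\<lambda>_. 0"]) simp
    next
      case False
      have "card {i. i < n \<and> p i < b} = card (p ` {i. i < n \<and> p i < b})"
        by (rule card_image[symmetric]) (use permutes_inj[OF p] in \<open>auto simp: inj_on_def\<close>)
      also have "p ` {i. i < n \<and> p i < b} = {0..<b}"
      proof -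
        have "j \<in> p ` {i. i < n \<and> p i < b}" if "j < b" for j
        proof -
          have "j \<in> p ` {0..<n}" using permutes_image[OF p] that assms(3,4) by auto
          then show ?thesis using that by auto
        qed
        then show ?thesis by auto
      qed
      finally have c1: "card {i. i < n \<and> p i < b} = b" by simp
      have "S = {a..<n} \<union> {i. i < n \<and> p i < b}" by (auto simp: S_def)
      moreover have "{a..<n} \<inter> {i. i < n \<and> p i < b} = {}" using False by auto
      ultimately have cS: "card S = n - ?k"
        using c1 assms(3,4) by (simp add: card_Un_disjoint)
      have finS: "finite S" "S \<subseteq> {0..<n}" by (auto simp: S_def)
      have cT: "card T = ?k"
        unfolding T_def using finS cS assms(3,4) by (simp add: card_Diff_subset)
      have "(\<Prod>i\<in>S. pencil X Y $$ (i, p i)) = (\<Prod>i\<in>S. lam * cnst (Y $$ (i, p i)))"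
        by (rule prod.cong) (use X ent pn in \<open>auto simp: S_def X_shape_def\<close>)
      also have "\<dots> = lam ^ (n - ?k) * cnst (\<Prod>i\<in>S. Y $$ (i, p i))"
        by (simp add: prod.distrib cS cnst_prod)
      finally have pS: "(\<Prod>i\<in>S. pencil X Y $$ (i, p i)) =
        lam ^ (n - ?k) * cnst (\<Prod>i\<in>S. Y $$ (i, p i))" .
      obtain c where c: "(\<Prod>i\<in>T. lam * cnst (Y $$ (i, p i)) + mu * cnst (X $$ (i, p i))) =
          (\<Sum>i=0..?k. cnst (c i) * mu ^ i * lam ^ (?k - i))"
        using prod_linear_forms[of T "\<lambda>i. Y $$ (i, p i)" "\<lambda>i. X $$ (i, p i)"] cT
        by (auto simp: T_def)
      have pT: "(\<Prod>i\<in>T. pencil X Y $$ (i, p i)) =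
          (\<Sum>i=0..?k. cnst (c i) * mu ^ i * lam ^ (?k - i))"
        unfolding c[symmetric] by (rule prod.cong) (use ent pn in \<open>auto simp: T_def\<close>)
      have "(\<Prod>i = 0..<n. pencil X Y $$ (i, p i)) =
          (\<Prod>i\<in>T. pencil X Y $$ (i, p i)) * (\<Prod>i\<in>S. pencil X Y $$ (i, p i))"
        unfolding T_def by (rule prod.subset_diff) (use finS in auto)
      also have "\<dots> = ?F (\<lambda>i. (\<Prod>i\<in>S. Y $$ (i, p i)) * c i)"
        unfolding pS pT by (simp add: sum_distrib_left sum_distrib_right mult_ac)
      finally show ?thesis by (rule exI[of _ "\<lambda>i. (\<Prod>i\<in>S. Y $$ (i, p i)) * c i"])
    qed
  qed
  have "\<forall>p. \<exists>c. p permutes {0..<n} \<longrightarrow> (\<Prod>i = 0..<n. pencil X Y $$ (i, p i)) = ?F c"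
  proof
    fix p :: "nat \<Rightarrow> nat"
    show "\<exists>c. p permutes {0..<n} \<longrightarrow> (\<Prod>i = 0..<n. pencil X Y $$ (i, p i)) = ?F c"
    proof (cases "p permutes {0..<n}")
      case True
      from ex[OF True] obtain c where "(\<Prod>i = 0..<n. pencil X Y $$ (i, p i)) = ?F c" ..
      then have "p permutes {0..<n} \<longrightarrow> (\<Prod>i = 0..<n. pencil X Y $$ (i, p i)) = ?F c" ..
      then show ?thesis by (rule exI[of _ c])
    qed simp
  qed
  from choice[OF this] obtain C where C: "\<And>p. p permutes {0..<n} \<Longrightarrow>
      (\<Prod>i = 0..<n. pencil X Y $$ (i, p i)) = ?F (C p)"
    by auto
  have sg: "signof p = cnst (signof p)" for p
    by (cases "evenperm p") (simp_all add: sign_def cnst_def one_pCons)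
  have "det (pencil X Y) = (\<Sum>p | p permutes {0..<n}. signof p * ?F (C p))"
    unfolding det_def'[OF car] by (rule sum.cong) (auto simp: C)
  also have "\<dots> = (\<Sum>p | p permutes {0..<n}. ?F (\<lambda>i. signof p * C p i))"
  proof (rule sum.cong[OF refl])
    fix p
    have "signof p * ?F (C p) = cnst (signof p) * ?F (C p)" by (subst sg) (rule refl)
    then show "signof p * ?F (C p) = ?F (\<lambda>i. signof p * C p i)"
      by (simp add: sum_distrib_left mult_ac)
  qed
  also have "\<dots> = ?F (\<lambda>i. \<Sum>p | p permutes {0..<n}. signof p * C p i)"
    unfolding sum_distrib_left[symmetric] cnst_sum sum_distrib_right
    by (subst sum.swap) (rule refl)
  finally show ?thesis unfolding pencil_coeffs_def
    by (rule exI[of _ "\<lambda>i. \<Sum>p | p permutes {0..<n}. signof p * C p i"])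
qed

end

theory Submission
  imports Defs "HOL-Library.Nat_Bijection"
begin

text \<open>
  Write \<open>F\<close> for the right-hand side. Removing the factor \<open>\<lambda>\<close> from the first \<open>b\<close> columns and the last
  \<open>n - a\<close> rows of the pencil turns \<open>F\<close> into a single determinant \<open>det C\<close>, evaluated at
  \<open>\<lambda> = \<phi>\<^sub>2\<close> and \<open>\<mu> = \<alpha>\<close>, where \<open>\<phi>\<^sub>2\<close> and \<open>\<alpha> = (-1) ^ (n - 1) * det (Y_bar n Y) * phi (n + 1)\<close> are the cofactors of the core
  at the positions \<open>(1, 1)\<close> and \<open>(n, 1)\<close>. The core is invariant under the shift by \<open>n - 1\<close> rows and
  \<open>n\<close> columns. Hence, modulo \<open>\<phi>\<^sub>1\<close>, the row \<open>\<rho>\<close> of cofactors of the first column and its shift both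
  lie in the left kernel of a matrix with one more row than columns, so they are proportional to
  the vector \<open>m\<close> of its signed maximal minors. Splitting \<open>\<rho>\<close> into blocks, this says that \<open>m\<close>
  annihilates \<open>C\<close> modulo \<open>\<phi>\<^sub>1\<close>, so \<open>\<phi>\<^sub>1\<close> divides every \<open>m\<^sub>r F\<close>.

  Both \<open>\<alpha>\<close> and \<open>\<phi>\<^sub>2\<close> are combinations of the \<open>m\<^sub>r\<close>, and every term of \<open>F\<close> contains one of them;
  therefore \<open>\<phi>\<^sub>1\<close> divides \<open>F\<^sup>2\<close>. Finally \<open>\<phi>\<^sub>1\<close> may be cancelled from the square: for suitable weights
  of the variables, the leading form of \<open>\<phi>\<^sub>1\<close> is the product of the main diagonal of the core, which
  consists of pairwise distinct variables, and a squarefree monomial that divides a square divides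
  its root.
\<close>

section \<open>Left kernels and cofactors\<close>

lemma pick_interval: "i < m - p \<Longrightarrow> pick {p..<m} i = i + p"
proof -
  assume i: "i < m - p"
  have "{x \<in> {p..<m}. x < i + p} = {p..<i + p}" using i by auto
  then show ?thesis using pick_card_in_set[of "i + p" "{p..<m}"] i by simp
qed

lemma submatrix_trailing:
  assumes "A \<in> carrier_mat m m"
  shows "submatrix A {p..<m} {q..<m} = mat (m - p) (m - q) (\<lambda>(i, j). A $$ (i + p, j + q))"
proof -
  have "{i. i < m \<and> i \<in> {s..<m}} = {s..<m}" for s by auto
  then have "card {i. i < m \<and> i \<in> {s..<m}} = m - s" for s by simp
  then show ?thesis using assms by (intro eq_matI) (auto simp: submatrix_def pick_interval)
qed

lemma det_block_lower_triangular:
  fixes A :: "'r :: idom mat"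
  assumes A: "A \<in> carrier_mat q q" and "p \<le> q"
    and zero: "\<And>i j. i < p \<Longrightarrow> p \<le> j \<Longrightarrow> j < q \<Longrightarrow> A $$ (i, j) = 0"
  shows "det A = det (mat p p (\<lambda>ij. A $$ ij)) *
           det (mat (q - p) (q - p) (\<lambda>(i, j). A $$ (i + p, j + p)))"
proof -
  let ?B = "mat (q - p) p (\<lambda>(i, j). A $$ (i + p, j))"
  have "A = four_block_mat (mat p p (\<lambda>ij. A $$ ij)) (0\<^sub>m p (q - p)) ?B
      (mat (q - p) (q - p) (\<lambda>(i, j). A $$ (i + p, j + p)))"
    using A \<open>p \<le> q\<close> zero by (intro eq_matI) auto
  then show ?thesis
    using det_four_block_mat_upper_right_zero
      [of "mat p p (\<lambda>ij. A $$ ij)" p "0\<^sub>m p (q - p)" "q - p" ?B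
        "mat (q - p) (q - p) (\<lambda>(i, j). A $$ (i + p, j + p))"] by auto
qed

lemma cofactor_column_sum:
  assumes A: "A \<in> carrier_mat n n" and "c < n" "j < n"
  shows "(\<Sum>i<n. cofactor A i j * A $$ (i, c)) = (if c = j then det A else 0)"
proof -
  have "(\<Sum>i<n. cofactor A i j * A $$ (i, c)) = (adj_mat A * A) $$ (j, c)"
    using A assms(2,3) by (simp add: adj_mat_def scalar_prod_def atLeast0LessThan)
  then show ?thesis using adj_mat(3)[OF A] assms(2,3) by simp
qed

lemma cofactor_row_sum:
  assumes A: "A \<in> carrier_mat n n" and "r < n" "i < n"
  shows "(\<Sum>c<n. A $$ (r, c) * cofactor A i c) = (if r = i then det A else 0)"
proof -
  have "(\<Sum>c<n. A $$ (r, c) * cofactor A i c) = (A * adj_mat A) $$ (r, i)"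
    using A assms(2,3) by (simp add: adj_mat_def scalar_prod_def atLeast0LessThan)
  then show ?thesis using adj_mat(2)[OF A] assms(2,3) by simp
qed

text \<open>Cramer's rule in the form used for divisibility: multiplying \<open>v A\<close> by the
  adjugate yields \<open>det A\<close> times \<open>v\<close>, so a common divisor of the entries of
  \<open>v A\<close> divides every \<open>v i * det A\<close>.\<close>

lemma det_mult_left_vec:
  fixes v :: "nat \<Rightarrow> 'r :: comm_ring_1"
  assumes A: "A \<in> carrier_mat n n" and "i < n"
  shows "v i * det A = (\<Sum>c<n. (\<Sum>r<n. v r * A $$ (r, c)) * cofactor A i c)"
proof -
  have "(\<Sum>c<n. (\<Sum>r<n. v r * A $$ (r, c)) * cofactor A i c)
      = (\<Sum>r<n. v r * (\<Sum>c<n. A $$ (r, c) * cofactor A i c))"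
    by (simp add: sum_distrib_left sum_distrib_right mult_ac) (rule sum.swap)
  also have "\<dots> = (\<Sum>r<n. if r = i then v i * det A else 0)"
    by (rule sum.cong) (use assms in \<open>auto simp: cofactor_row_sum\<close>)
  finally show ?thesis using assms(2) by simp
qed

text \<open>Here \<open>f\<close> stands for a matrix with \<open>M + 1\<close> rows and
  \<open>M\<close> columns, of which row \<open>0\<close> is dropped.\<close>

definition lower_rows :: "nat \<Rightarrow> (nat \<Rightarrow> nat \<Rightarrow> 'r) \<Rightarrow> 'r :: comm_ring_1 mat" where
  "lower_rows M f = mat M M (\<lambda>(i, j). f (Suc i) j)"

text \<open>The signed maximal minors of \<open>f\<close>: for \<open>Suc r\<close>, the sum is the
  determinant of \<open>lower_rows M f\<close> with row \<open>r\<close> replaced by row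
  \<open>0\<close> of \<open>f\<close>.\<close>

fun left_kernel :: "nat \<Rightarrow> (nat \<Rightarrow> nat \<Rightarrow> 'r) \<Rightarrow> nat \<Rightarrow> 'r :: comm_ring_1" where
  "left_kernel M f 0 = det (lower_rows M f)"
| "left_kernel M f (Suc r) = - (\<Sum>c<M. f 0 c * cofactor (lower_rows M f) r c)"

text \<open>Coefficients of the error term in \<open>left_kernel_proportional\<close>, which
  vanishes at index \<open>0\<close>.\<close>

fun cofactor_below :: "nat \<Rightarrow> (nat \<Rightarrow> nat \<Rightarrow> 'r) \<Rightarrow> nat \<Rightarrow> nat \<Rightarrow> 'r :: comm_ring_1" where
  "cofactor_below M f 0 c = 0"
| "cofactor_below M f (Suc r) c = cofactor (lower_rows M f) r c"

lemma lower_rows_carrier [simp]: "lower_rows M f \<in> carrier_mat M M"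
  by (simp add: lower_rows_def)

lemma lower_rows_index [simp]: "i < M \<Longrightarrow> j < M \<Longrightarrow> lower_rows M f $$ (i, j) = f (Suc i) j"
  by (simp add: lower_rows_def)

text \<open>Expanding by cofactors, the rows below row \<open>0\<close> contribute
  \<open>- f 0 c * det (lower_rows M f)\<close>, which cancels the contribution of row
  \<open>0\<close>.\<close>

lemma left_kernel_annihilates:
  assumes "c < M"
  shows "(\<Sum>r\<le>M. left_kernel M f r * f r c) = 0"
proof -
  let ?A = "lower_rows M f"
  have "(\<Sum>r<M. left_kernel M f (Suc r) * f (Suc r) c)
      = - (\<Sum>r<M. \<Sum>e<M. f 0 e * cofactor ?A r e * ?A $$ (r, c))"
    using assms by (simp add: sum_distrib_right flip: sum_negf)
  also have "\<dots> = - (\<Sum>e<M. f 0 e * (\<Sum>r<M. cofactor ?A r e * ?A $$ (r, c)))"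
    by (subst sum.swap) (simp add: sum_distrib_left mult_ac)
  also have "(\<Sum>e<M. f 0 e * (\<Sum>r<M. cofactor ?A r e * ?A $$ (r, c)))
      = (\<Sum>e<M. if e = c then f 0 c * det ?A else 0)"
  proof (rule sum.cong[OF refl])
    fix e assume "e \<in> {..<M}"
    then have "(\<Sum>r<M. cofactor ?A r e * ?A $$ (r, c)) = (if c = e then det ?A else 0)"
      by (intro cofactor_column_sum) (use assms in auto)
    then show "f 0 e * (\<Sum>r<M. cofactor ?A r e * ?A $$ (r, c)) =
        (if e = c then f 0 c * det ?A else 0)" by (simp only:) simp
  qed
  finally show ?thesis using assms
    by (simp add: lessThan_Suc_atMost[symmetric] sum.lessThan_Suc_shift del: sum.lessThan_Suc)
qed

text \<open>The tail of \<open>y\<close> times \<open>lower_rows M f\<close> is \<open>y f\<close>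
  minus \<open>y 0\<close> times row \<open>0\<close>; Cramer's rule turns the second part into
  \<open>y 0 * left_kernel M f r\<close>. The explicit error term makes this usable when
  \<open>y f\<close> vanishes only modulo some element.\<close>

lemma left_kernel_proportional:
  assumes "r \<le> M"
  shows "left_kernel M f 0 * y r = y 0 * left_kernel M f r +
           (\<Sum>c<M. (\<Sum>i\<le>M. y i * f i c) * cofactor_below M f r c)"
proof (cases r)
  case (Suc s)
  let ?A = "lower_rows M f"
  have s: "s < M" using assms Suc by simp
  have "y (Suc s) * det ?A = (\<Sum>c<M. (\<Sum>i<M. y (Suc i) * ?A $$ (i, c)) * cofactor ?A s c)"
    by (rule det_mult_left_vec) (use s in auto)
  also have "\<dots> = (\<Sum>c<M. ((\<Sum>i\<le>M. y i * f i c) - y 0 * f 0 c) * cofactor ?A s c)"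
    by (rule sum.cong) (auto simp: lessThan_Suc_atMost[symmetric] sum.lessThan_Suc_shift
        simp del: sum.lessThan_Suc)
  also have "\<dots> = (\<Sum>c<M. (\<Sum>i\<le>M. y i * f i c) * cofactor ?A s c) +
      y 0 * left_kernel M f (Suc s)"
    by (simp add: left_diff_distrib sum_subtractf mult.assoc flip: sum_distrib_left)
  finally show ?thesis
    by (simp add: Suc mult.commute)
qed simp

section \<open>Divisibility of the square\<close>

lemma sum_lessThan_add:
  fixes g :: "nat \<Rightarrow> 'a :: comm_monoid_add"
  shows "(\<Sum>r<d + k. g r) = (\<Sum>r<d. g r) + (\<Sum>r<k. g (r + d))"
  by (induction k) (auto simp: ac_simps)

text \<open>The pencil \<open>p Y + q X\<close> without the factor \<open>p\<close> of its first \<open>b\<close> columns and last \<open>n - a\<close> rows.\<close>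

definition reduced_pencil ::
    "nat \<Rightarrow> nat \<Rightarrow> nat \<Rightarrow> 'r :: comm_ring_1 mat \<Rightarrow> 'r mat \<Rightarrow> 'r \<Rightarrow> 'r \<Rightarrow> 'r mat" where
  "reduced_pencil n a b X Y p q = mat n n (\<lambda>(i, j).
     if j < b \<or> a \<le> i then Y $$ (i, j) else p * Y $$ (i, j) + q * X $$ (i, j))"

locale core_pencil =
  fixes n a b :: nat and X Y :: "'r :: idom mat"
  assumes X: "X_shape n a b X" and Y: "Y_shape n a b Y" and a_le: "a \<le> n" and b_less: "b + 1 < a"
begin

abbreviation "Phi \<equiv> core n a b X Y"
abbreviation "N \<equiv> core_size n a b"
definition d :: nat where "d = n - 1"
definition M :: nat where "M = N - n"
abbreviation "ker \<equiv> left_kernel M (\<lambda>r c. Phi $$ (r, c))"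

definition rho :: "nat \<Rightarrow> 'r" where
  "rho r = cofactor Phi r 0"

section \<open>Dimensions, zero pattern and periodicity of the core\<close>

lemma n_eq: "Suc d = n" and d_pos: "0 < d"
  using a_le b_less by (auto simp: d_def)

lemma add_n: "i + n = Suc (i + d)"
  using n_eq by simp

lemma N_eq: "N = n + ((a - b - 2) * n + b)"
proof -
  have "a - b - 1 = Suc (a - b - 2)" using b_less by simp
  then show ?thesis by (simp add: core_size_def)
qed

lemma M_eq: "M = (a - b - 2) * n + b"
  by (simp add: N_eq M_def)

lemma Suc_M: "Suc M = (a - b - 2) * d + (a - 1)"
proof -
  have "(a - b - 2) * n = (a - b - 2) * d + (a - b - 2)"
    using mult_Suc_right[of "a - b - 2" d] n_eq by simp
  then show ?thesis using b_less unfolding M_eq by linarith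
qed

lemma N_split: "d + Suc M = N" and N_split': "n + M = N" and a_le_M: "a - 1 \<le> Suc M"
  using N_eq M_eq n_eq Suc_M by linarith+

lemma Phi_carrier [simp]: "Phi \<in> carrier_mat N N"
  by (simp add: core_def)

lemma Phi_dim [simp]: "dim_row Phi = N" "dim_col Phi = N"
  by (simp_all add: core_def)

lemma X_zero: "i < n \<Longrightarrow> j < n \<Longrightarrow> a \<le> i \<or> j < b \<Longrightarrow> X $$ (i, j) = 0"
  using X by (auto simp: X_shape_def)

lemma Y_zero: "i < n \<Longrightarrow> j < n \<Longrightarrow> a \<le> i \<Longrightarrow> j < b \<Longrightarrow> Y $$ (i, j) = 0"
  using Y by (auto simp: Y_shape_def)

lemma Phi_index:
  assumes "r < N" "c < N"
  shows "Phi $$ (r, c) =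
    (if c div n = r div d then Y $$ (r mod d + 1, c mod n)
     else if c div n + 1 = r div d then X $$ (r mod d + 1, c mod n) else 0)"
  using assms by (simp add: core_def d_def)

text \<open>The shift raises both block indices by one and keeps the position inside the block. By
  \<open>N_split\<close> and \<open>N_split'\<close> it carries the first \<open>M + 1\<close> rows
  and \<open>M\<close> columns to the last ones.\<close>

lemma Phi_period:
  assumes "r \<le> M" "c < M"
  shows "Phi $$ (r + d, c + n) = Phi $$ (r, c)"
proof -
  have "0 < n" using n_eq by simp
  then have "(c + n) div n = c div n + 1" "(r + d) div d = r div d + 1"
    using d_pos by auto
  then show ?thesis
    using assms N_split N_split' by (simp add: Phi_index)
qed

lemma Phi_top:
  assumes "r < d" "c < N"
  shows "Phi $$ (r, c) = (if c < n then Y $$ (r + 1, c) else 0)"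
proof -
  have "c div n = 0 \<longleftrightarrow> c < n" using n_eq by (metis div_eq_0_iff nat.distinct(1))
  then show ?thesis using assms N_split by (auto simp: Phi_index)
qed

lemma Phi_first_columns:
  assumes "r \<le> M" "c < n"
  shows "Phi $$ (r + d, c) = (if r < a - 1 then X $$ (r + 1, c) else 0)"
proof (cases "r < d")
  case True
  then have "(r + d) div d = 1" by (simp add: d_pos)
  then show ?thesis using True assms N_split N_split' by (auto simp: Phi_index intro!: X_zero)
next
  case False
  then have "(r + d) div d \<ge> 2" using d_pos by (simp add: div_greater_zero_iff Suc_le_eq)
  then show ?thesis using False assms N_split N_split' a_le by (auto simp: Phi_index)
qed

text \<open>By \<open>Suc_M\<close>, such a row lies in block row \<open>?K\<close> with source row
  at least \<open>a\<close>, or in a later block row; by \<open>M_eq\<close>, such a column is among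
  the first \<open>b\<close> of block column \<open>?K\<close>, or in an earlier one. Only
  prescribed zeros of \<open>X\<close> and \<open>Y\<close> and zero blocks meet there.\<close>

lemma Phi_corner:
  assumes "M < r" "r < N" "c < M"
  shows "Phi $$ (r, c) = 0"
proof -
  let ?K = "a - b - 2"
  have n0: "0 < n" using n_eq by simp
  have r1: "?K * d + (a - 1) \<le> r" using Suc_M assms(1) by simp
  have "?K \<le> r div d" using r1 d_pos
    by (metis add_leD1 div_le_mono nonzero_mult_div_cancel_right not_gr_zero)
  have row: "a - 1 \<le> r mod d" if "r div d = ?K"
    using r1 that div_mult_mod_eq[of r d] by simp
  have rm: "r mod d + 1 < n" using d_pos mod_less_divisor[of d r] n_eq by linarith
  have cm: "c mod n < n" using n0 by simp
  have c1: "c < ?K * n + b" using assms(3) M_eq by simp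
  have "c div n \<le> ?K"
  proof -
    have "c < Suc ?K * n" using c1 a_le b_less by simp
    then show ?thesis using n0 by (simp add: less_mult_imp_div_less flip: less_Suc_eq_le)
  qed
  have col: "c mod n < b" if "c div n = ?K"
    using c1 that div_mult_mod_eq[of c n] by simp
  have rl: "r div d = ?K \<Longrightarrow> a \<le> r mod d + 1" using row by simp
  consider "c div n = r div d" | "c div n + 1 = r div d" "c div n = ?K"
    | "c div n + 1 = r div d" "r div d = ?K" | "c div n \<noteq> r div d" "c div n + 1 \<noteq> r div d"
    using \<open>?K \<le> r div d\<close> \<open>c div n \<le> ?K\<close> by linarith
  then show ?thesis
  proof cases
    case 1
    then have "r div d = ?K" "c div n = ?K" using \<open>?K \<le> r div d\<close> \<open>c div n \<le> ?K\<close> by auto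
    then show ?thesis using 1 assms N_split' row col rm cm by (simp add: Phi_index Y_zero)
  next
    case 2
    then show ?thesis using assms N_split' col rm cm by (simp add: Phi_index X_zero)
  next
    case 3
    then show ?thesis using assms N_split' rl rm cm by (simp add: Phi_index X_zero)
  next
    case 4
    then show ?thesis using assms N_split' by (simp add: Phi_index)
  qed
qed

section \<open>Cofactors of the first column against the kernel vector\<close>

lemma rho_sum:
  "c < N \<Longrightarrow> (\<Sum>r<N. rho r * Phi $$ (r, c)) = (if c = 0 then det Phi else 0)"
  using cofactor_column_sum[OF Phi_carrier, of c 0] by (simp add: rho_def)

text \<open>By \<open>Phi_corner\<close> the first \<open>M\<close> columns meet only the first
  \<open>M + 1\<close> rows, so the truncated \<open>rho\<close> still gives \<open>det Phi\<close>
  in column \<open>0\<close> and zero in the others. If \<open>M = 0\<close>, there is no column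
  \<open>0\<close> and no error.\<close>

lemma ker_rho:
  assumes "r \<le> M"
  shows "ker 0 * rho r = rho 0 * ker r +
    det Phi * (if M = 0 then 0 else cofactor_below M (\<lambda>r c. Phi $$ (r, c)) r 0)"
proof -
  have "(\<Sum>i\<le>M. rho i * Phi $$ (i, c)) = (if c = 0 then det Phi else 0)" if "c < M" for c
  proof -
    have "(\<Sum>i\<le>M. rho i * Phi $$ (i, c)) = (\<Sum>i<N. rho i * Phi $$ (i, c))"
      by (rule sum.mono_neutral_left) (use N_split that Phi_corner in auto)
    then show ?thesis using rho_sum[of c] that N_split' by simp
  qed
  then have "(\<Sum>c<M. (\<Sum>i\<le>M. rho i * Phi $$ (i, c)) * cofactor_below M (\<lambda>r c. Phi $$ (r, c)) r c)
      = (\<Sum>c<M. if c = 0 then det Phi * cofactor_below M (\<lambda>r c. Phi $$ (r, c)) r 0 else 0)"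
    by (intro sum.cong) auto
  then show ?thesis
    using left_kernel_proportional[OF assms, of "\<lambda>r c. Phi $$ (r, c)" rho] by simp
qed

text \<open>The columns from \<open>n\<close> on vanish in the top \<open>d\<close> rows, so the
  tail of \<open>rho\<close> alone annihilates the shifted block. Column \<open>0\<close> is not
  among them; hence the identity is exact.\<close>

lemma ker_rho_shift:
  assumes "r \<le> M"
  shows "ker 0 * rho (r + d) = rho d * ker r"
proof -
  have "(\<Sum>i\<le>M. rho (i + d) * Phi $$ (i, c)) = 0" if "c < M" for c
  proof -
    have "(\<Sum>i\<le>M. rho (i + d) * Phi $$ (i, c)) = (\<Sum>i<Suc M. rho (i + d) * Phi $$ (i + d, c + n))"
      unfolding lessThan_Suc_atMost by (rule sum.cong) (use that Phi_period in auto)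
    also have "\<dots> = (\<Sum>i<d + Suc M. rho i * Phi $$ (i, c + n))"
      unfolding sum_lessThan_add by (use that N_split' in \<open>simp add: Phi_top del: sum.lessThan_Suc\<close>)
    finally show ?thesis
      using rho_sum[of "c + n"] that N_split' n_eq unfolding N_split by simp
  qed
  then show ?thesis
    using left_kernel_proportional[OF assms, of "\<lambda>r c. Phi $$ (r, c)" "\<lambda>r. rho (r + d)"] by simp
qed

section \<open>A row vector annihilating the reduced pencil modulo \<open>det Phi\<close>\<close>

abbreviation "C \<equiv> reduced_pencil n a b X Y (rho 0) (rho d)"

text \<open>Row \<open>0\<close> of \<open>X\<close> and \<open>Y\<close> does not enter the core,
  hence the value \<open>0\<close>. In the columns from \<open>b\<close> on, for
  \<open>j < a\<close> the matrix \<open>C\<close> supplies the factor \<open>rho 0\<close>, and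
  \<open>rho 0 * ker (j - 1)\<close> is congruent to \<open>ker 0 * rho (j - 1)\<close>; from row
  \<open>a\<close> on \<open>C\<close> lacks this factor, so the latter value is inserted
  directly.\<close>

definition annihilator :: "nat \<Rightarrow> 'r" where
  "annihilator j = (if j = 0 then 0 else if j < a then ker (j - 1) else ker 0 * rho (j - 1))"

text \<open>In a column before \<open>b\<close> the sum is the product of \<open>ker\<close> with
  that column of the core, which is zero. In the others, trading \<open>rho 0 * ker r\<close> and
  \<open>rho d * ker r\<close> for \<open>ker 0 * rho r\<close> and
  \<open>ker 0 * rho (r + d)\<close> leaves \<open>ker 0\<close> times an entry of
  \<open>rho Phi\<close>.\<close>

lemma det_Phi_dvd_annihilator_C:
  assumes "c < n"
  shows "det Phi dvd (\<Sum>j<n. annihilator j * C $$ (j, c))"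
proof -
  have shift: "(\<Sum>j<n. annihilator j * C $$ (j, c)) = (\<Sum>r<d. annihilator (Suc r) * C $$ (Suc r, c))"
    using sum.lessThan_Suc_shift[of "\<lambda>j. annihilator j * C $$ (j, c)" d]
    by (simp add: n_eq annihilator_def del: sum.lessThan_Suc)
  show ?thesis
  proof (cases "c < b")
    case True
    have "(\<Sum>r<d. annihilator (Suc r) * C $$ (Suc r, c)) = (\<Sum>r<a - 1. ker r * Y $$ (Suc r, c))"
      by (rule sum.mono_neutral_cong_right)
        (use True assms a_le n_eq in \<open>auto simp: reduced_pencil_def annihilator_def Y_zero\<close>)
    also have "\<dots> = (\<Sum>r\<le>M. ker r * Phi $$ (r, c))"
    proof (rule sum.mono_neutral_cong_left)
      show "\<forall>r\<in>{..M} - {..<a - 1}. ker r * Phi $$ (r, c) = 0"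
      proof
        fix r assume r: "r \<in> {..M} - {..<a - 1}"
        have "Phi $$ (r, c) = 0"
        proof (cases "r < d")
          case True
          then show ?thesis using r \<open>c < b\<close> assms N_split' n_eq by (auto simp: Phi_top Y_zero)
        next
          case False
          then show ?thesis using Phi_first_columns[of "r - d" c] r \<open>c < b\<close> assms a_le
            by (auto simp: X_zero split: if_splits)
        qed
        then show "ker r * Phi $$ (r, c) = 0" by simp
      qed
    qed (use a_le_M a_le n_eq assms N_split' in \<open>auto simp: Phi_top\<close>)
    also have "\<dots> = 0"
    proof (rule left_kernel_annihilates)
      show "c < M" using M_eq True by simp
    qed
    finally show ?thesis by (simp add: shift)
  next
    case False
    \<comment> \<open>The cofactor of \<open>det Phi\<close> in the error term of
      \<open>ker_rho\<close>, with the same default for \<open>M = 0\<close>.\<close>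
    define s where
      "s r = (if M = 0 then 0 else cofactor_below M (\<lambda>r c. Phi $$ (r, c)) r 0)" for r
    have termwise: "annihilator (Suc r) * C $$ (Suc r, c) = ker 0 * (rho r * Y $$ (Suc r, c)) +
      (if r < a - 1 then ker 0 * (rho (r + d) * X $$ (Suc r, c)) - det Phi * (s r * Y $$ (Suc r, c))
       else 0)" if "r < d" for r
    proof (cases "r < a - 1")
      case True
      then have r: "r \<le> M" using a_le_M by simp
      have "annihilator (Suc r) * C $$ (Suc r, c) =
          rho 0 * ker r * Y $$ (Suc r, c) + rho d * ker r * X $$ (Suc r, c)"
        using that True False assms n_eq by (auto simp: annihilator_def reduced_pencil_def algebra_simps)
      also have "rho 0 * ker r = ker 0 * rho r - det Phi * s r"
        using ker_rho[OF r] by (simp add: s_def algebra_simps)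
      also have "rho d * ker r = ker 0 * rho (r + d)"
        using ker_rho_shift[OF r] by simp
      finally show ?thesis using True by (simp add: algebra_simps)
    next
      case False
      then show ?thesis using that assms n_eq by (auto simp: annihilator_def reduced_pencil_def)
    qed
    have "(\<Sum>r<d. if r < a - 1 then ker 0 * (rho (r + d) * X $$ (Suc r, c)) -
          det Phi * (s r * Y $$ (Suc r, c)) else 0) =
        (\<Sum>r<a - 1. ker 0 * (rho (r + d) * X $$ (Suc r, c)) - det Phi * (s r * Y $$ (Suc r, c)))"
      by (rule sum.mono_neutral_cong_right) (use a_le n_eq in auto)
    then have "(\<Sum>r<d. annihilator (Suc r) * C $$ (Suc r, c)) =
        ker 0 * ((\<Sum>r<d. rho r * Y $$ (Suc r, c)) + (\<Sum>r<a - 1. rho (r + d) * X $$ (Suc r, c)))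
        - det Phi * (\<Sum>r<a - 1. s r * Y $$ (Suc r, c))"
      by (simp add: termwise sum.distrib sum_subtractf distrib_left flip: sum_distrib_left)
    also have "(\<Sum>r<a - 1. rho (r + d) * X $$ (Suc r, c)) =
        (\<Sum>r<Suc M. rho (r + d) * Phi $$ (r + d, c))"
      by (rule sum.mono_neutral_cong_left)
        (use a_le_M assms in \<open>auto simp: Phi_first_columns\<close>)
    also have "(\<Sum>r<d. rho r * Y $$ (Suc r, c)) = (\<Sum>r<d. rho r * Phi $$ (r, c))"
      by (rule sum.cong) (use assms N_split' in \<open>auto simp: Phi_top\<close>)
    also have "\<dots> + (\<Sum>r<Suc M. rho (r + d) * Phi $$ (r + d, c)) = (\<Sum>r<N. rho r * Phi $$ (r, c))"
      by (simp only: sum_lessThan_add flip: N_split)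
    also have "\<dots> = (if c = 0 then det Phi else 0)"
      using rho_sum assms N_split' by simp
    finally show ?thesis by (simp add: shift)
  qed
qed

lemma det_Phi_dvd_ker:
  assumes "r < a - 1"
  shows "det Phi dvd ker r * det C"
proof -
  have "annihilator (Suc r) * det C = (\<Sum>c<n. (\<Sum>j<n. annihilator j * C $$ (j, c)) * cofactor C (Suc r) c)"
    by (rule det_mult_left_vec) (use assms a_le in \<open>auto simp: reduced_pencil_def\<close>)
  moreover have "det Phi dvd \<dots>"
    by (intro dvd_sum dvd_mult2 det_Phi_dvd_annihilator_C) auto
  moreover have "annihilator (Suc r) = ker r" using assms by (auto simp: annihilator_def)
  ultimately show ?thesis by simp
qed

section \<open>The trailing minors as kernel entries and cofactors\<close>

lemma lower_rows_Phi:
  "lower_rows M (\<lambda>r c. Phi $$ (r, c)) = mat M M (\<lambda>(i, j). Phi $$ (i + n, j + n))"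
proof (rule eq_matI)
  fix i j assume "i < dim_row (mat M M (\<lambda>(i, j). Phi $$ (i + n, j + n)))"
    "j < dim_col (mat M M (\<lambda>(i, j). Phi $$ (i + n, j + n)))"
  then have ij: "i < M" "j < M" by auto
  have "i + n = Suc i + d" using n_eq by simp
  then show "lower_rows M (\<lambda>r c. Phi $$ (r, c)) $$ (i, j) =
      mat M M (\<lambda>(i, j). Phi $$ (i + n, j + n)) $$ (i, j)"
    using ij Phi_period[of "Suc i" j] by (simp add: add_n)
qed (auto simp: lower_rows_def)

lemma ker_0: "ker 0 = det (mat M M (\<lambda>(i, j). Phi $$ (i + n, j + n)))"
  by (simp add: lower_rows_Phi)

lemma phi_1: "phi n a b X Y 1 = det Phi"
proof -
  have "mat N N (\<lambda>(i, j). Phi $$ (i + 0, j + 0)) = Phi"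
    by (rule eq_matI) (auto simp: core_def)
  then show ?thesis by (simp add: phi_def submatrix_trailing[OF Phi_carrier])
qed

lemma phi_2: "phi n a b X Y 2 = rho 0"
proof -
  have "mat (N - 1) (N - 1) (\<lambda>(i, j). Phi $$ (i + 1, j + 1)) = mat_delete Phi 0 0"
    by (rule eq_matI) (auto simp: core_def mat_delete_def)
  then show ?thesis
    by (simp add: phi_def submatrix_trailing[OF Phi_carrier] rho_def cofactor_def)
qed

lemma phi_n1: "phi n a b X Y (n + 1) = ker 0"
  by (simp add: ker_0 phi_def submatrix_trailing[OF Phi_carrier] del: left_kernel.simps flip: M_def)

lemma Y_bar_eq: "Y_bar n Y = mat d d (\<lambda>(i, j). Y $$ (i + 1, j + 1))"
  using submatrix_trailing[of Y n 1 1] Y by (simp add: Y_bar_def Y_shape_def d_def)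

text \<open>Once row \<open>d\<close> and column \<open>0\<close> are deleted, the top
  \<open>d\<close> rows meet only the first \<open>d\<close> columns; the determinant splits into
  that of \<open>Y_bar\<close> and the trailing minor \<open>ker 0\<close>.\<close>

lemma rho_d: "rho d = (-1) ^ d * det (Y_bar n Y) * ker 0"
proof -
  let ?D = "mat_delete Phi d 0"
  have D: "?D \<in> carrier_mat (N - 1) (N - 1)" by (simp add: core_def mat_delete_def)
  have "det ?D = det (mat d d (\<lambda>ij. ?D $$ ij)) *
      det (mat (N - 1 - d) (N - 1 - d) (\<lambda>(i, j). ?D $$ (i + d, j + d)))"
    by (rule det_block_lower_triangular[OF D])
      (use N_split N_split' n_eq in \<open>auto simp: mat_delete_def Phi_top\<close>)
  also have "mat d d (\<lambda>ij. ?D $$ ij) = mat d d (\<lambda>(i, j). Y $$ (i + 1, j + 1))"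
    by (rule eq_matI) (use N_split N_split' n_eq in \<open>auto simp: mat_delete_def Phi_top\<close>)
  also have "mat (N - 1 - d) (N - 1 - d) (\<lambda>(i, j). ?D $$ (i + d, j + d)) =
      mat M M (\<lambda>(i, j). Phi $$ (i + n, j + n))"
    by (rule eq_matI) (use N_split in \<open>auto simp: mat_delete_def add_n\<close>)
  finally show ?thesis
    by (simp add: rho_def cofactor_def ker_0 Y_bar_eq del: left_kernel.simps)
qed

text \<open>Cramer's rule for the minor \<open>rho 0\<close>, with \<open>ker\<close> placed on the
  rows of the core from \<open>d\<close> on. By periodicity the product vanishes outside the first
  \<open>d\<close> columns, where it is \<open>ker\<close> times entries of \<open>X\<close>; the
  cofactors involved contain \<open>ker 0\<close>, which then cancels.\<close>

lemma rho_0_ideal: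
  assumes "ker 0 \<noteq> 0"
  shows "\<exists>w. rho 0 = (\<Sum>r<a - 1. ker r * w r)"
proof -
  let ?P = "mat_delete Phi 0 0"
  have P: "?P \<in> carrier_mat (N - 1) (N - 1)" by (simp add: mat_delete_def)
  have P_index: "?P $$ (i, j) = Phi $$ (i + 1, j + 1)" if "i < N - 1" "j < N - 1" for i j
    using that by (simp add: mat_delete_def)
  have N1: "N - 1 = (d - 1) + Suc M" using N_split d_pos by simp
  \<comment> \<open>Row \<open>d - 1\<close> of \<open>?P\<close> is row \<open>d\<close> of the
    core, so \<open>v (d - 1)\<close> is \<open>ker 0\<close>.\<close>
  define v where "v r = (if r < d - 1 then 0 else ker (r - (d - 1)))" for r
  have vP: "(\<Sum>r<N - 1. v r * ?P $$ (r, c)) =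
      (if c < d then \<Sum>r<a - 1. ker r * X $$ (r + 1, c + 1) else 0)" if c: "c < N - 1" for c
  proof -
    have "(\<Sum>r<d - 1. v r * ?P $$ (r, c)) = 0"
      by (rule sum.neutral) (simp add: v_def)
    moreover have "(\<Sum>r<Suc M. v (r + (d - 1)) * ?P $$ (r + (d - 1), c)) =
        (\<Sum>r<Suc M. ker r * Phi $$ (r + d, c + 1))"
    proof (rule sum.cong[OF refl])
      fix r assume "r \<in> {..<Suc M}"
      then have "r + (d - 1) < N - 1" "r + (d - 1) + 1 = r + d" using N1 d_pos by auto
      then show "v (r + (d - 1)) * ?P $$ (r + (d - 1), c) = ker r * Phi $$ (r + d, c + 1)"
        using c by (simp only: P_index) (simp add: v_def)
    qed
    ultimately have "(\<Sum>r<N - 1. v r * ?P $$ (r, c)) = (\<Sum>r<Suc M. ker r * Phi $$ (r + d, c + 1))"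
      unfolding N1 sum_lessThan_add by (simp only: add_0)
    also have "\<dots> = (if c < d then \<Sum>r<a - 1. ker r * X $$ (r + 1, c + 1) else 0)"
    proof (cases "c < d")
      case True
      have "(\<Sum>r<Suc M. ker r * Phi $$ (r + d, c + 1)) = (\<Sum>r<a - 1. ker r * X $$ (r + 1, c + 1))"
        by (rule sum.mono_neutral_cong_right)
          (use a_le_M True n_eq in \<open>auto simp: Phi_first_columns\<close>)
      then show ?thesis using True by simp
    next
      case False
      then obtain e where e: "c = e + d" by (metis add.commute le_Suc_ex not_le)
      then have "e < M" and cn: "c + 1 = e + n" using c N_split n_eq by auto
      then have "(\<Sum>r<Suc M. ker r * Phi $$ (r + d, c + 1)) = (\<Sum>r\<le>M. ker r * Phi $$ (r, e))"
        unfolding lessThan_Suc_atMost cn by (intro sum.cong) (auto simp: Phi_period)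
      then show ?thesis using False left_kernel_annihilates[OF \<open>e < M\<close>] by simp
    qed
    finally show ?thesis .
  qed
  \<comment> \<open>After row \<open>d - 1\<close> and column \<open>c\<close> are deleted, the
    first \<open>d - 1\<close> rows vanish from column \<open>d - 1\<close> on; the lower right
    block is the trailing one with determinant \<open>ker 0\<close>.\<close>
  have cof: "ker 0 dvd cofactor ?P (d - 1) c" if "c < d" for c
  proof -
    let ?D = "mat_delete ?P (d - 1) c"
    have "?D \<in> carrier_mat (N - 1 - 1) (N - 1 - 1)" by (rule mat_delete_carrier[OF P])
    moreover have "?D $$ (i, j) = 0" if "i < d - 1" "d - 1 \<le> j" "j < N - 1 - 1" for i j
      using that \<open>c < d\<close> N_split n_eq P by (simp add: mat_delete_def Phi_top)
    ultimately have "det ?D = det (mat (d - 1) (d - 1) (\<lambda>ij. ?D $$ ij)) *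
        det (mat (N - 1 - 1 - (d - 1)) (N - 1 - 1 - (d - 1)) (\<lambda>(i, j). ?D $$ (i + (d - 1), j + (d - 1))))"
      by (intro det_block_lower_triangular) (use N_split in auto)
    also have "mat (N - 1 - 1 - (d - 1)) (N - 1 - 1 - (d - 1)) (\<lambda>(i, j). ?D $$ (i + (d - 1), j + (d - 1))) =
        mat M M (\<lambda>(i, j). Phi $$ (i + n, j + n))"
    proof (rule eq_matI)
      fix i j
      assume "i < dim_row (mat M M (\<lambda>(i, j). Phi $$ (i + n, j + n)))"
        "j < dim_col (mat M M (\<lambda>(i, j). Phi $$ (i + n, j + n)))"
      then have ij: "i < M" "j < M" by auto
      then have bounds: "i + (d - 1) < N - 1 - 1" "j + (d - 1) < N - 1 - 1"
          "i + (d - 1) + 1 < N - 1" "j + (d - 1) + 1 < N - 1"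
        using N_split d_pos by auto
      have "\<not> i + (d - 1) < d - 1" "\<not> j + (d - 1) < c" using that by auto
      have "?D $$ (i + (d - 1), j + (d - 1)) = ?P $$ (i + (d - 1) + 1, j + (d - 1) + 1)"
        using bounds that P \<open>\<not> i + (d - 1) < d - 1\<close> \<open>\<not> j + (d - 1) < c\<close>
        unfolding mat_delete_def[of ?P] by simp
      also have "\<dots> = Phi $$ (i + n, j + n)"
        using bounds d_pos by (simp only: P_index) (simp add: add_n)
      finally show "mat (N - 1 - 1 - (d - 1)) (N - 1 - 1 - (d - 1))
            (\<lambda>(i, j). ?D $$ (i + (d - 1), j + (d - 1))) $$ (i, j) =
          mat M M (\<lambda>(i, j). Phi $$ (i + n, j + n)) $$ (i, j)"
        using ij N_split d_pos by (simp only: index_mat split)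
    qed (use N_split d_pos in auto)
    finally show ?thesis by (simp add: cofactor_def ker_0 del: left_kernel.simps)
  qed
  then obtain u where u: "cofactor ?P (d - 1) c = ker 0 * u c" if "c < d" for c
    unfolding dvd_def by metis
  have "v (d - 1) * det ?P = (\<Sum>c<N - 1. (\<Sum>r<N - 1. v r * ?P $$ (r, c)) * cofactor ?P (d - 1) c)"
    by (rule det_mult_left_vec[OF P]) (use N1 in simp)
  also have "\<dots> = (\<Sum>c<d. (\<Sum>r<a - 1. ker r * X $$ (r + 1, c + 1)) * (ker 0 * u c))"
  proof (rule sum.mono_neutral_cong_right)
    show "(\<Sum>r<N - 1. v r * ?P $$ (r, c)) * cofactor ?P (d - 1) c =
        (\<Sum>r<a - 1. ker r * X $$ (r + 1, c + 1)) * (ker 0 * u c)" if "c \<in> {..<d}" for c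
    proof -
      have "c < d" "c < N - 1" using that N_split by auto
      then show ?thesis by (simp only: vP u if_True)
    qed
    show "\<forall>c\<in>{..<N - 1} - {..<d}.
        (\<Sum>r<N - 1. v r * ?P $$ (r, c)) * cofactor ?P (d - 1) c = 0"
    proof
      fix c assume "c \<in> {..<N - 1} - {..<d}"
      then have "\<not> c < d" "c < N - 1" by auto
      then show "(\<Sum>r<N - 1. v r * ?P $$ (r, c)) * cofactor ?P (d - 1) c = 0"
        by (simp only: vP if_False mult_zero_left)
    qed
  qed (use N_split in auto)
  also have "\<dots> = ker 0 * (\<Sum>r<a - 1. ker r * (\<Sum>c<d. X $$ (r + 1, c + 1) * u c))"
    by (simp add: sum_distrib_left sum_distrib_right mult_ac del: left_kernel.simps) (rule sum.swap)
  finally have "ker 0 * rho 0 = ker 0 * (\<Sum>r<a - 1. ker r * (\<Sum>c<d. X $$ (r + 1, c + 1) * u c))"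
    by (simp add: v_def rho_def cofactor_def del: left_kernel.simps)
  then show ?thesis using assms by auto
qed

text \<open>Both \<open>rho 0\<close> and \<open>rho d\<close> are combinations of the
  \<open>ker r\<close> with \<open>r < a - 1\<close>, to which \<open>det_Phi_dvd_ker\<close>
  applies.\<close>

lemma phi_dvd:
  assumes "phi n a b X Y (n + 1) \<noteq> 0"
  shows "phi n a b X Y 1 dvd phi n a b X Y 2 * det C" "phi n a b X Y 1 dvd rho d * det C"
proof -
  obtain w where w: "rho 0 = (\<Sum>r<a - 1. ker r * w r)"
    using rho_0_ideal assms unfolding phi_n1 by blast
  have "det Phi dvd (\<Sum>r<a - 1. w r * (ker r * det C))"
    by (intro dvd_sum dvd_mult det_Phi_dvd_ker) auto
  then show "phi n a b X Y 1 dvd phi n a b X Y 2 * det C"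
    unfolding phi_1 phi_2 by (subst w) (simp add: sum_distrib_left mult_ac)
  have "det Phi dvd (-1) ^ d * det (Y_bar n Y) * (ker 0 * det C)"
    by (intro dvd_mult det_Phi_dvd_ker) (use b_less in simp)
  then show "phi n a b X Y 1 dvd rho d * det C"
    unfolding phi_1 by (subst rho_d) (simp add: mult_ac del: left_kernel.simps)
qed

end

section \<open>Substitution homomorphisms of polynomials\<close>

text \<open>Any linear order on the variables will do: the library has \<open>idom\<close> for polynomial mappings only
  over linearly ordered exponents.\<close>

fun entry_code :: "entry \<Rightarrow> nat" where
  "entry_code (X_ent i j) = 2 * prod_encode (i, j)"
| "entry_code (Y_ent i j) = 2 * prod_encode (i, j) + 1"

lemma entry_code_inj: "entry_code u = entry_code v \<Longrightarrow> u = v"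
proof -
  have "2 * (i :: nat) \<noteq> 2 * j + 1" for i j by presburger
  then show "entry_code u = entry_code v \<Longrightarrow> u = v"
    by (cases u; cases v) (simp_all, metis+)
qed

instantiation entry :: linorder
begin

definition less_eq_entry :: "entry \<Rightarrow> entry \<Rightarrow> bool" where
  "u \<le> v \<longleftrightarrow> entry_code u \<le> entry_code v"

definition less_entry :: "entry \<Rightarrow> entry \<Rightarrow> bool" where
  "u < v \<longleftrightarrow> entry_code u < entry_code v"

instance
  by standard (auto simp: less_eq_entry_def less_entry_def intro: entry_code_inj)

end

definition monomial_value :: "(entry \<Rightarrow> 'r :: comm_ring_1) \<Rightarrow> (entry \<Rightarrow>\<^sub>0 nat) \<Rightarrow> 'r" where
  "monomial_value f m = (\<Prod>v\<in>Poly_Mapping.keys m. f v ^ Poly_Mapping.lookup m v)"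

text \<open>The separate map \<kappa> on coefficients lets one construction cover evaluation,
  restriction to some variables and the grading by weights.\<close>

definition subst_poly ::
    "(complex \<Rightarrow> 'r :: comm_ring_1) \<Rightarrow> (entry \<Rightarrow> 'r) \<Rightarrow> entry_poly \<Rightarrow> 'r" where
  "subst_poly \<kappa> f p =
     (\<Sum>m\<in>Poly_Mapping.keys p. \<kappa> (Poly_Mapping.lookup p m) * monomial_value f m)"

lemma monomial_value_superset:
  assumes "finite V" "Poly_Mapping.keys m \<subseteq> V"
  shows "monomial_value f m = (\<Prod>v\<in>V. f v ^ Poly_Mapping.lookup m v)"
  unfolding monomial_value_def using assms
  by (intro prod.mono_neutral_left) (auto simp: in_keys_iff)

lemma monomial_value_add: "monomial_value f (m + m') = monomial_value f m * monomial_value f m'"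
proof -
  let ?V = "Poly_Mapping.keys m \<union> Poly_Mapping.keys m'"
  have "monomial_value f (m + m') = (\<Prod>v\<in>?V. f v ^ Poly_Mapping.lookup (m + m') v)"
    by (rule monomial_value_superset) (use Poly_Mapping.keys_add[of m m'] in auto)
  also have "\<dots> = (\<Prod>v\<in>?V. f v ^ Poly_Mapping.lookup m v) * (\<Prod>v\<in>?V. f v ^ Poly_Mapping.lookup m' v)"
    by (simp add: lookup_add power_add prod.distrib)
  finally show ?thesis
    by (simp add: monomial_value_superset[of ?V])
qed

lemma poly_mapping_sum_singles:
  "p = (\<Sum>m\<in>Poly_Mapping.keys p. Poly_Mapping.single m (Poly_Mapping.lookup p m))"
  by (rule poly_mapping_eqI) (auto simp: lookup_sum lookup_single when_def in_keys_iff)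

lemma poly_mapping_additive_induct:
  fixes p :: "'a \<Rightarrow>\<^sub>0 'b :: comm_monoid_add"
  assumes "P 0" "\<And>m c. P (Poly_Mapping.single m c)" "\<And>p q. P p \<Longrightarrow> P q \<Longrightarrow> P (p + q)"
  shows "P p"
proof -
  have "P (\<Sum>m\<in>S. Poly_Mapping.single m (Poly_Mapping.lookup p m))" if "finite S" for S
    using that by induction (auto intro: assms)
  then show ?thesis by (subst poly_mapping_sum_singles) simp
qed

lemma subst_poly_superset:
  assumes "\<kappa> 0 = 0" "finite S" "Poly_Mapping.keys p \<subseteq> S"
  shows "subst_poly \<kappa> f p = (\<Sum>m\<in>S. \<kappa> (Poly_Mapping.lookup p m) * monomial_value f m)"
  unfolding subst_poly_def using assms
  by (intro sum.mono_neutral_left) (auto simp: in_keys_iff)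

locale coefficient_hom = comm_ring_hom \<kappa> for \<kappa> :: "complex \<Rightarrow> 'r :: comm_ring_1"
begin

lemma subst_poly_single:
  "subst_poly \<kappa> f (Poly_Mapping.single m c) = \<kappa> c * monomial_value f m"
  by (simp add: subst_poly_def)

lemma subst_poly_add: "subst_poly \<kappa> f (p + q) = subst_poly \<kappa> f p + subst_poly \<kappa> f q"
proof -
  let ?S = "Poly_Mapping.keys p \<union> Poly_Mapping.keys q"
  have "subst_poly \<kappa> f (p + q) =
      (\<Sum>m\<in>?S. \<kappa> (Poly_Mapping.lookup (p + q) m) * monomial_value f m)"
    by (rule subst_poly_superset) (use Poly_Mapping.keys_add[of p q] in auto)
  then show ?thesis
    by (simp add: subst_poly_superset[of \<kappa> ?S] lookup_add hom_add distrib_right sum.distrib)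
qed

lemma subst_poly_mult: "subst_poly \<kappa> f (p * q) = subst_poly \<kappa> f p * subst_poly \<kappa> f q"
proof (induction p rule: poly_mapping_additive_induct)
  case (2 m c)
  show ?case
    by (induction q rule: poly_mapping_additive_induct)
      (auto simp: subst_poly_def[of _ _ 0] mult_single subst_poly_single monomial_value_add hom_mult
        distrib_left distrib_right subst_poly_add mult_ac)
qed (auto simp: subst_poly_def[of _ _ 0] distrib_right subst_poly_add)

lemma subst_poly_hom: "comm_ring_hom (subst_poly \<kappa> f)"
proof
  show "subst_poly \<kappa> f 1 = 1"
    using subst_poly_single[of f 0 1] by (simp add: monomial_value_def flip: single_one)
qed (auto simp: subst_poly_add subst_poly_mult subst_poly_def[of _ _ 0])

lemma subst_poly_indet: "subst_poly \<kappa> f (indet v) = f v"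
  by (simp add: indet_def subst_poly_single monomial_value_def)

end

definition const_poly :: "complex \<Rightarrow> entry_poly" where
  "const_poly c = Poly_Mapping.single 0 c"

definition coeff_poly :: "complex \<Rightarrow> entry_poly poly" where
  "coeff_poly c = [:const_poly c:]"

lemma coefficient_hom_id: "coefficient_hom (\<lambda>c. c)"
  by standard auto

interpretation retract: coefficient_hom const_poly
  by standard (auto simp: const_poly_def single_add mult_single)

interpretation weigh: coefficient_hom coeff_poly
  by standard (auto simp: coeff_poly_def const_poly_def single_add mult_single one_pCons mult.commute)

lemma single_eq_monomial: "Poly_Mapping.single m c = const_poly c * monomial_value indet m"
proof -
  have pow: "indet v ^ k = Poly_Mapping.single (Poly_Mapping.single v k) 1" for v k
  proof (induction k)
    case (Suc k)
    have "Poly_Mapping.single v (Suc k) = Poly_Mapping.single v 1 + Poly_Mapping.single v k"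
      using single_add[of v 1 k] by simp
    then show ?case using Suc by (simp add: indet_def mult_single)
  qed simp
  have prod: "(\<Prod>v\<in>V. Poly_Mapping.single (g v) (1 :: complex)) = Poly_Mapping.single (\<Sum>v\<in>V. g v) 1"
    if "finite V" for V and g :: "entry \<Rightarrow> entry \<Rightarrow>\<^sub>0 nat"
    using that by induction (auto simp: mult_single)
  have "monomial_value indet m = Poly_Mapping.single m 1"
    unfolding monomial_value_def pow prod[OF finite_keys]
    by (subst poly_mapping_sum_singles[of m, symmetric]) (rule refl)
  then show ?thesis by (simp add: const_poly_def mult_single)
qed

text \<open>Serves two purposes: testing divisibility by a variable, and removing foreign variables
  from a quotient.\<close>

definition restrict_to :: "entry set \<Rightarrow> entry_poly \<Rightarrow> entry_poly" where
  "restrict_to V = subst_poly const_poly (\<lambda>v. if v \<in> V then indet v else 0)"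

lemma restrict_to_hom: "comm_ring_hom (restrict_to V)"
  unfolding restrict_to_def by (rule retract.subst_poly_hom)

interpretation restrict: comm_ring_hom "restrict_to V" for V
  by (rule restrict_to_hom)

lemma restrict_to_indet: "restrict_to V (indet v) = (if v \<in> V then indet v else 0)"
  by (simp add: restrict_to_def retract.subst_poly_indet)

lemma restrict_to_single:
  "restrict_to V (Poly_Mapping.single m c) =
     (if Poly_Mapping.keys m \<subseteq> V then Poly_Mapping.single m c else 0)"
proof (cases "Poly_Mapping.keys m \<subseteq> V")
  case True
  have "monomial_value (\<lambda>v. if v \<in> V then indet v else 0) m = monomial_value indet m"
    unfolding monomial_value_def by (rule prod.cong) (use True in auto)
  then show ?thesis using True
    by (simp add: restrict_to_def retract.subst_poly_single flip: single_eq_monomial)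
next
  case False
  then have "monomial_value (\<lambda>v. if v \<in> V then indet v else 0) m = 0"
    unfolding monomial_value_def by (intro prod_zero) (auto simp: in_keys_iff)
  then show ?thesis using False
    by (simp add: restrict_to_def retract.subst_poly_single)
qed

lemma polynomial_in_add: "polynomial_in V p \<Longrightarrow> polynomial_in V q \<Longrightarrow> polynomial_in V (p + q)"
  unfolding polynomial_in_def using Poly_Mapping.keys_add[of p q] by blast

lemma polynomial_in_restrict_to: "polynomial_in V (restrict_to V p)"
  by (induction p rule: poly_mapping_additive_induct)
    (auto simp: restrict_to_single restrict.hom_add polynomial_in_add, auto simp: polynomial_in_def)

lemma eval_at_eq: "eval_at X Y = subst_poly (\<lambda>c. c) (entry_value X Y)"
  by (auto simp: eval_at_def subst_poly_def monomial_value_def fun_eq_iff)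

text \<open>A polynomial and its restriction differ only by monomials containing \<open>v\<close>,
  so they agree modulo \<open>indet v\<close>.\<close>

lemma indet_dvd_iff: "indet v dvd p \<longleftrightarrow> restrict_to (- {v}) p = 0"
proof
  assume "indet v dvd p"
  then show "restrict_to (- {v}) p = 0"
    by (auto simp: dvd_def restrict.hom_mult restrict_to_indet)
next
  have "indet v dvd p - restrict_to (- {v}) p"
  proof (induction p rule: poly_mapping_additive_induct)
    case (2 m c)
    show ?case
    proof (cases "v \<in> Poly_Mapping.keys m")
      case True
      have "indet v dvd indet v ^ Poly_Mapping.lookup m v"
        using True by (intro dvd_power) (auto simp: in_keys_iff)
      also have "\<dots> dvd monomial_value indet m"
        unfolding monomial_value_def using True by (intro dvd_prodI) auto
      finally show ?thesis using True
        by (auto simp: restrict_to_single) (simp add: single_eq_monomial)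
    next
      case False
      then have "Poly_Mapping.keys m \<subseteq> - {v}" by auto
      then show ?thesis by (simp add: restrict_to_single)
    qed
  next
    case (3 p q)
    then show ?case using dvd_add[of "indet v"] by (simp add: restrict.hom_add add_diff_add)
  qed auto
  moreover assume "restrict_to (- {v}) p = 0"
  ultimately show "indet v dvd p" by simp
qed

lemma indet_nonzero: "indet v \<noteq> 0"
  unfolding indet_def by (metis lookup_single_eq lookup_zero zero_neq_one)

text \<open>The multiples of a variable are the kernel of a homomorphism into a domain, so a
  variable is prime.\<close>

lemma indet_dvd_multD: "indet v dvd p * q \<Longrightarrow> indet v dvd p \<or> indet v dvd q"
  by (simp add: indet_dvd_iff restrict.hom_mult)

text \<open>Induction on \<open>V\<close>: with \<open>p = ?D * h\<close>, cancelling one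
  \<open>?D\<close> shows that the new variable divides \<open>?D * h * h\<close>; being prime and
  no divisor of \<open>?D\<close>, it divides \<open>h\<close>.\<close>

lemma squarefree_monomial_dvd:
  assumes "finite V" "(\<Prod>v\<in>V. indet v) dvd p * p"
  shows "(\<Prod>v\<in>V. indet v) dvd p"
  using assms
proof (induction V)
  case (insert v V)
  let ?D = "\<Prod>v\<in>V. indet v"
  have prod: "(\<Prod>u\<in>insert v V. indet u) = indet v * ?D" using insert.hyps by simp
  have "?D dvd p * p" using insert.prems unfolding prod by (rule dvd_mult_right)
  then have "?D dvd p" by (rule insert.IH)
  then obtain h where h: "p = ?D * h" by (rule dvdE)
  obtain q where "p * p = indet v * ?D * q" using insert.prems unfolding prod by (rule dvdE)
  then have "?D * (?D * h * h) = ?D * (indet v * q)" unfolding h by (simp only: mult_ac)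
  moreover have D0: "?D \<noteq> 0" using insert.hyps by (simp add: indet_nonzero)
  ultimately have "?D * h * h = indet v * q" by (metis mult_left_cancel)
  then have "indet v dvd ?D * h * h" by simp
  moreover have "\<not> indet v dvd ?D"
  proof -
    have "restrict_to (- {v}) ?D = (\<Prod>u\<in>V. indet u)"
      unfolding restrict.hom_prod by (rule prod.cong) (use insert.hyps in \<open>auto simp: restrict_to_indet\<close>)
    then show ?thesis using D0 by (simp add: indet_dvd_iff)
  qed
  ultimately have "indet v dvd h" using indet_dvd_multD by blast
  then have "?D * indet v dvd p" unfolding h by (rule mult_dvd_mono[OF dvd_refl])
  then show ?case unfolding prod by (simp only: mult.commute)
qed simp

section \<open>Squarefree leading forms\<close>

text \<open>The coefficient of degree \<open>e\<close> is the component of weight \<open>e\<close>,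
  so the leading coefficient is the leading form.\<close>

definition weigh_by :: "(entry \<Rightarrow> nat) \<Rightarrow> entry_poly \<Rightarrow> entry_poly poly" where
  "weigh_by w = subst_poly coeff_poly (\<lambda>v. monom (indet v) (w v))"

lemma weigh_by_hom: "comm_ring_hom (weigh_by w)"
  unfolding weigh_by_def by (rule weigh.subst_poly_hom)

interpretation weigh_by: comm_ring_hom "weigh_by w" for w
  by (rule weigh_by_hom)

lemma weigh_by_indet: "weigh_by w (indet v) = monom (indet v) (w v)"
  by (simp add: weigh_by_def weigh.subst_poly_indet)

lemma prod_monom: "(\<Prod>i\<in>I. monom (x i) (k i)) = monom (\<Prod>i\<in>I. x i) (\<Sum>i\<in>I. k i)"
  by (induction I rule: infinite_finite_induct) (auto simp: mult_monom simp flip: one_pCons)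

lemma weigh_by_single:
  "weigh_by w (Poly_Mapping.single m c) = monom (Poly_Mapping.single m c)
     (\<Sum>v\<in>Poly_Mapping.keys m. w v * Poly_Mapping.lookup m v)"
proof -
  have "monomial_value (\<lambda>v. monom (indet v) (w v)) m = monom (monomial_value indet m)
      (\<Sum>v\<in>Poly_Mapping.keys m. w v * Poly_Mapping.lookup m v)"
    unfolding monomial_value_def prod_monom[symmetric]
    by (intro prod.cong) (auto simp: monom_power)
  then show ?thesis
    by (simp add: weigh_by_def weigh.subst_poly_single coeff_poly_def smult_monom
        flip: single_eq_monomial)
qed

lemma weigh_by_at_1: "poly (weigh_by w p) 1 = p"
  by (induction p rule: poly_mapping_additive_induct)
    (auto simp: weigh_by_single weigh_by.hom_add poly_monom)

lemma weigh_by_eq_0_iff: "weigh_by w p = 0 \<longleftrightarrow> p = 0"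
  using weigh_by_at_1[of w p] by auto

lemma weigh_by_coeff: "weigh_by w (coeff (weigh_by w p) e) = monom (coeff (weigh_by w p) e) e"
  by (induction p rule: poly_mapping_additive_induct)
    (auto simp: weigh_by_single weigh_by.hom_add add_monom)

text \<open>\<open>F\<close> is reduced modulo \<open>f\<close>: its leading form is divisible by that of \<open>f\<close>, so the weight drops.\<close>

lemma dvd_of_dvd_square:
  assumes "finite V" and lead: "lead_coeff (weigh_by w f) = (\<Prod>v\<in>V. indet v)"
    and "f dvd F * F"
  shows "f dvd F"
  using assms(3)
proof (induction "degree (weigh_by w F)" arbitrary: F rule: less_induct)
  case less
  let ?D = "\<Prod>v\<in>V. indet v" and ?G = "weigh_by w F"
  let ?d = "degree ?G" and ?e = "degree (weigh_by w f)"
  show ?case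
  proof (cases "F = 0")
    case False
    then have G0: "lead_coeff ?G \<noteq> 0" by (simp add: weigh_by_eq_0_iff)
    have D0: "?D \<noteq> 0" using assms(1) by (simp add: indet_nonzero)
    obtain q where q: "F * F = f * q" using less.prems by (rule dvdE)
    then have "?G * ?G = weigh_by w f * weigh_by w q" by (simp flip: weigh_by.hom_mult)
    then have "lead_coeff ?G * lead_coeff ?G = ?D * lead_coeff (weigh_by w q)"
      by (metis lead lead_coeff_mult)
    then have "?D dvd lead_coeff ?G * lead_coeff ?G" by (simp only: dvd_triv_left)
    then have "?D dvd lead_coeff ?G" by (rule squarefree_monomial_dvd[OF assms(1)])
    then obtain h where h: "lead_coeff ?G = ?D * h" by (rule dvdE)
    \<comment> \<open>\<open>?D\<close> and \<open>?D * h\<close> are leading forms, hence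
      homogeneous; cancelling \<open>?D\<close> will make \<open>h\<close> homogeneous of weight
      \<open>?d - ?e\<close>.\<close>
    have "monom ?D ?e * weigh_by w h = monom (?D * h) ?d"
      using weigh_by_coeff[of w F ?d] weigh_by_coeff[of w f ?e]
      unfolding h lead by (simp only: weigh_by.hom_mult)
    then have shifted: "coeff (monom ?D ?e * weigh_by w h) i = coeff (monom (?D * h) ?d) i" for i
      by simp
    have "?e \<le> ?d"
    proof (rule ccontr)
      assume "\<not> ?e \<le> ?d"
      then show False using shifted[of ?d] G0 h by (simp add: coeff_monom_mult)
    qed
    have "weigh_by w h = monom h (?d - ?e)"
    proof (rule poly_eqI)
      fix i
      have "?D * coeff (weigh_by w h) i = (if ?d = i + ?e then ?D * h else 0)"
        using shifted[of "i + ?e"] by (simp add: coeff_monom_mult)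
      then show "coeff (weigh_by w h) i = coeff (monom h (?d - ?e)) i"
        using D0 \<open>?e \<le> ?d\<close> by (auto split: if_splits)
    qed
    then have F': "weigh_by w (F - f * h) = ?G - monom h (?d - ?e) * weigh_by w f"
      by (simp add: weigh_by.hom_minus weigh_by.hom_mult mult.commute)
    \<comment> \<open>At weight \<open>?d\<close> the leading forms of \<open>F\<close> and
      \<open>f * h\<close> cancel; above it both have no component.\<close>
    have small: "coeff (weigh_by w (F - f * h)) i = 0" if "i \<ge> ?d" for i
    proof (cases "i = ?d")
      case True
      have "coeff (monom h (?d - ?e) * weigh_by w f) ?d = h * ?D"
        using \<open>?e \<le> ?d\<close> lead by (simp add: coeff_monom_mult)
      then show ?thesis using h unfolding F' True by (simp add: mult.commute)
    next
      case False
      then show ?thesis using that \<open>?e \<le> ?d\<close> unfolding F'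
        by (simp add: coeff_monom_mult coeff_eq_0)
    qed
    have sq: "f dvd (F - f * h) * (F - f * h)"
    proof -
      have "(F - f * h) * (F - f * h) = F * F + f * (f * h * h - F * h - F * h)"
        by (simp add: algebra_simps)
      then show ?thesis using less.prems by (simp only: dvd_add_left_iff dvd_triv_left)
    qed
    have "f dvd F - f * h"
    proof (cases "F - f * h = 0")
      case True
      then show ?thesis by simp
    next
      case False
      then have "lead_coeff (weigh_by w (F - f * h)) \<noteq> 0" by (simp add: weigh_by_eq_0_iff)
      then have "degree (weigh_by w (F - f * h)) < ?d" using small by (meson not_le)
      then show ?thesis using less.hyps sq by blast
    qed
    then show ?thesis by (metis dvd_add_left_iff dvd_triv_left diff_add_cancel add.commute)
  qed simp
qed

section \<open>Leading forms of determinants and of the core minors\<close>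

lemma signof_mult_monom: "signof p * monom x k = monom (signof p * x) k"
  by (cases "evenperm p") (simp_all add: sign_def minus_monom)

text \<open>Twice the difference is the sum of the squares of \<open>i - p i\<close>, positive as
  soon as \<open>p\<close> moves a point.\<close>

lemma sum_mult_permutes_less:
  assumes "p permutes {0..<m}" "p \<noteq> id"
  shows "(\<Sum>i = 0..<m. int i * int (p i)) < (\<Sum>i = 0..<m. int i * int i)"
proof -
  obtain j where j: "p j \<noteq> j" using assms(2) by (auto simp: fun_eq_iff)
  then have "j \<in> {0..<m}" using assms(1) by (auto simp: permutes_def)
  then have "0 < (\<Sum>i = 0..<m. (int i - int (p i))\<^sup>2)"
    using j by (intro sum_pos2[of _ j]) auto
  also have "\<dots> = (\<Sum>i = 0..<m. int i * int i) + (\<Sum>i = 0..<m. int (p i) * int (p i))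
      - 2 * (\<Sum>i = 0..<m. int i * int (p i))"
    by (simp add: power2_eq_square algebra_simps sum.distrib sum_subtractf sum_distrib_left)
  also have "(\<Sum>i = 0..<m. int (p i) * int (p i)) = (\<Sum>i = 0..<m. int i * int i)"
    using sum.permute[OF assms(1), of "\<lambda>i. int i * int i"] by (simp add: comp_def)
  finally show ?thesis by simp
qed

text \<open>If the weights of the entries are \<open>i j\<close> up to terms depending on the row or the column alone, the
  main diagonal is the unique heaviest transversal, by the rearrangement inequality.\<close>

lemma weigh_by_det:
  fixes \<alpha> \<beta> :: "nat \<Rightarrow> int"
  assumes A: "A \<in> carrier_mat m m"
    and ent: "\<And>i j. i < m \<Longrightarrow> j < m \<Longrightarrow> weigh_by w (A $$ (i, j)) = monom (A $$ (i, j)) (\<omega> i j)"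
    and pot: "\<And>i j. i < m \<Longrightarrow> j < m \<Longrightarrow> A $$ (i, j) \<noteq> 0 \<Longrightarrow>
      2 * int (\<omega> i j) = 2 * (int i * int j) + \<alpha> i + \<beta> j"
    and diag: "(\<Prod>i = 0..<m. A $$ (i, i)) \<noteq> 0"
  shows "lead_coeff (weigh_by w (det A)) = (\<Prod>i = 0..<m. A $$ (i, i))"
proof -
  let ?P = "{p. p permutes {0..<m}}"
  define x where "x p = signof p * (\<Prod>i = 0..<m. A $$ (i, p i))" for p
  define W where "W p = (\<Sum>i = 0..<m. \<omega> i (p i))" for p
  have pm: "p i < m" if "p permutes {0..<m}" "i < m" for p i
    using permutes_in_image[OF that(1), of i] that(2) by simp
  have "weigh_by w (det A) = (\<Sum>p\<in>?P. signof p * (\<Prod>i = 0..<m. weigh_by w (A $$ (i, p i))))"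
    unfolding det_def'[OF A] by (simp add: weigh_by.hom_sum weigh_by.hom_mult weigh_by.hom_prod)
  also have "\<dots> = (\<Sum>p\<in>?P. monom (x p) (W p))"
  proof (rule sum.cong[OF refl])
    fix p assume "p \<in> ?P"
    then have "(\<Prod>i = 0..<m. weigh_by w (A $$ (i, p i))) = (\<Prod>i = 0..<m. monom (A $$ (i, p i)) (\<omega> i (p i)))"
      by (intro prod.cong ent) (auto simp: pm)
    then show "signof p * (\<Prod>i = 0..<m. weigh_by w (A $$ (i, p i))) = monom (x p) (W p)"
      by (simp add: prod_monom signof_mult_monom x_def W_def)
  qed
  finally have det: "weigh_by w (det A) = (\<Sum>p\<in>?P. monom (x p) (W p))" .
  have fin: "finite ?P" by (simp add: finite_permutations)
  \<comment> \<open>The row and column terms have the same total for every permutation, so only the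
    sums of \<open>i * p i\<close> are compared.\<close>
  have less: "W p < W id" if "p \<in> ?P" "p \<noteq> id" "x p \<noteq> 0" for p
  proof -
    have p: "p permutes {0..<m}" using that by simp
    have "A $$ (i, p i) \<noteq> 0" if "i < m" for i
      using \<open>x p \<noteq> 0\<close> that by (auto simp: x_def)
    then have "2 * int (W p) = (\<Sum>i = 0..<m. 2 * (int i * int (p i)) + \<alpha> i + \<beta> (p i))"
      unfolding W_def by (simp add: sum_distrib_left pot pm[OF p])
    also have "\<dots> = 2 * (\<Sum>i = 0..<m. int i * int (p i)) + sum \<alpha> {0..<m} + sum \<beta> {0..<m}"
      using sum.permute[OF p, of \<beta>] by (simp add: sum.distrib sum_distrib_left comp_def)
    also have "\<dots> < 2 * (\<Sum>i = 0..<m. int i * int i) + sum \<alpha> {0..<m} + sum \<beta> {0..<m}"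
      using sum_mult_permutes_less[OF p that(2)] by simp
    also have "\<dots> = (\<Sum>i = 0..<m. 2 * (int i * int i) + \<alpha> i + \<beta> i)"
      by (simp add: sum.distrib sum_distrib_left)
    also have "\<dots> = 2 * int (W id)"
      using diag unfolding W_def by (simp add: sum_distrib_left pot)
    finally show ?thesis by simp
  qed
  have id: "id \<in> ?P" by (simp add: permutes_id)
  have "coeff (weigh_by w (det A)) (W id) = (\<Sum>p\<in>?P. if p = id then x id else 0)"
    unfolding det coeff_sum by (rule sum.cong) (use less in fastforce)+
  also have "\<dots> = x id" using fin id by simp
  also have "x id = (\<Prod>i = 0..<m. A $$ (i, i))" by (simp add: x_def)
  finally have top: "coeff (weigh_by w (det A)) (W id) = (\<Prod>i = 0..<m. A $$ (i, i))" .
  have "degree (weigh_by w (det A)) \<le> W id"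
  proof (rule degree_le, intro allI impI)
    fix e assume e: "W id < e"
    have "coeff (monom (x p) (W p)) e = 0" if "p \<in> ?P" for p
      using less[OF that] e by (cases "p = id"; cases "x p = 0") auto
    then show "coeff (weigh_by w (det A)) e = 0" unfolding det coeff_sum by simp
  qed
  moreover have "W id \<le> degree (weigh_by w (det A))"
    using top diag by (intro le_degree) simp
  ultimately show ?thesis using top by simp
qed

text \<open>Up to row and column terms, \<open>r c\<close> is the same function of the entry for all occurrences of this
  entry in the core; this function is the weight. The shift \<open>n (n - i)\<close> only keeps it nonnegative.\<close>

fun entry_weight :: "nat \<Rightarrow> entry \<Rightarrow> nat" where
  "entry_weight n (Y_ent i j) = i * j"
| "entry_weight n (X_ent i j) = i * j + (n - 1) * j + n * (n - i)"

text \<open>The variable occupying a position on the two block diagonals; the \<open>X\<close> case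
  is also the default off them.\<close>

definition core_entry :: "nat \<Rightarrow> nat \<Rightarrow> nat \<Rightarrow> entry" where
  "core_entry n r c =
     (if c div n = r div (n - 1) then Y_ent (r mod (n - 1) + 1) (c mod n)
      else X_ent (r mod (n - 1) + 1) (c mod n))"

lemma core_entry_weight:
  fixes n :: nat
  assumes "2 \<le> n"
  obtains \<alpha> \<beta> :: "nat \<Rightarrow> int" where
    "\<And>r c. c div n = r div (n - 1) \<or> c div n + 1 = r div (n - 1) \<Longrightarrow>
       2 * int (entry_weight n (core_entry n r c)) = 2 * (int r * int c) + \<alpha> r + \<beta> c"
proof -
  define d where "d = n - 1"
  have n: "n = d + 1" and d0: "0 < d" using assms by (auto simp: d_def)
  \<comment> \<open>With \<open>r = i * d + j\<close> and \<open>c = i' * n + q\<close>, the term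
    \<open>2 * i * i'\<close> equals \<open>i * (i + 1) + i' * (i' - 1)\<close> on the
    \<open>Y\<close> blocks and two less on the \<open>X\<close> blocks; doubling avoids fractions.
    The terms \<open>4 * i\<close> cancel on the \<open>Y\<close> blocks and on the \<open>X\<close>
    blocks adjust the constant to the shift in \<open>entry_weight\<close>.\<close>
  define A where "A i j = - (2 * i * (int d + 1) * j + int d * (int d + 1) * (i * (i + 1) - 4 * i))"
    for i j :: int
  define B where "B i q = - (2 * i * int d * q - 2 * q + int d * (int d + 1) * (i * (i - 1) + 4 * i))"
    for i q :: int
  have main: "2 * int (entry_weight n (core_entry n r c)) = 2 * (int r * int c) +
      A (int (r div d)) (int (r mod d)) + B (int (c div n)) (int (c mod n))"
    if rc: "c div n = r div d \<or> c div n + 1 = r div d" for r c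
  proof -
    define i j i' q where "i = r div d" and "j = r mod d" and "i' = c div n" and "q = c mod n"
    have "r = i * d + j" "c = i' * n + q" by (auto simp: i_def j_def i'_def q_def)
    then have r: "int r = int i * int d + int j" and c: "int c = int i' * (int d + 1) + int q"
      by (auto simp: n algebra_simps)
    have j: "j < d" using d0 by (simp add: j_def)
    show ?thesis
    proof (cases "i' = i")
      case True
      then have "int (entry_weight n (core_entry n r c)) = (int j + 1) * int q"
        by (simp add: core_entry_def i_def j_def i'_def q_def d_def algebra_simps)
      then show ?thesis
        unfolding r c i_def[symmetric] j_def[symmetric] i'_def[symmetric] q_def[symmetric]
          A_def B_def True
        by (simp add: algebra_simps)
    next
      case False
      then have i: "i = i' + 1" using rc by (auto simp: i_def i'_def)
      have weight: "entry_weight n (core_entry n r c) = (j + 1) * q + d * q + n * (d - j)"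
        using False by (simp add: core_entry_def i_def j_def i'_def q_def d_def)
      have "int (entry_weight n (core_entry n r c)) =
          (int j + 1) * int q + int d * int q + (int d + 1) * (int d - int j)"
        unfolding weight by (simp only: n of_nat_add of_nat_mult of_nat_1 of_nat_diff[OF less_imp_le[OF j]])
      moreover have "int i = int i' + 1" using i by simp
      ultimately show ?thesis
        unfolding r c i_def[symmetric] j_def[symmetric] i'_def[symmetric] q_def[symmetric]
          A_def B_def
        by (simp add: algebra_simps)
    qed
  qed
  show ?thesis
    by (rule that[of "\<lambda>r. A (int (r div d)) (int (r mod d))" "\<lambda>c. B (int (c div n)) (int (c mod n))"])
      (use main in \<open>simp add: d_def\<close>)
qed

text \<open>From \<open>r = i * n + q = i * d + (i + q)\<close>, the diagonal sinks by one row per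
  block column and passes from the \<open>Y\<close> block into the \<open>X\<close> block below. The
  bound on \<open>i\<close> keeps it off the prescribed zeros.\<close>

lemma core_diagonal:
  assumes "a \<le> n" "b + 1 < a" "r < core_size n a b"
  shows "if r div n + r mod n < n - 1
    then r div (n - 1) = r div n \<and> r mod (n - 1) = r div n + r mod n \<and>
      Y_ent (r div n + r mod n + 1) (r mod n) \<in> free_entries n a b
    else r div (n - 1) = r div n + 1 \<and> r mod (n - 1) = r div n + r mod n - (n - 1) \<and>
      X_ent (r div n + r mod n - (n - 1) + 1) (r mod n) \<in> free_entries n a b"
proof -
  define d i q where "d = n - 1" and "i = r div n" and "q = r mod n"
  have n: "n = d + 1" and d0: "0 < d" using assms by (auto simp: d_def)
  have q: "q \<le> d" using n by (simp add: q_def flip: less_Suc_eq_le)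
  have "r = i * n + q" by (simp add: i_def q_def)
  then have r: "r = i * d + (i + q)" by (simp add: n)
  \<comment> \<open>This is the number of block columns of full width, one less than
    \<open>a - b\<close>.\<close>
  define k where "k = a - b - 1"
  have k: "a = k + b + 1" "1 \<le> k" using assms by (auto simp: k_def)
  have size: "r < k * n + b" using assms(3) by (simp add: core_size_def k_def)
  have "i \<le> k"
  proof (rule ccontr)
    assume "\<not> i \<le> k"
    then have "(k + 1) * n \<le> i * n" by (intro mult_le_mono1) simp
    then show False using size \<open>r = i * n + q\<close> assms k by simp
  qed
  have last: "q < b" if "i = k" using size \<open>r = i * n + q\<close> that by simp
  show ?thesis unfolding d_def[symmetric] i_def[symmetric] q_def[symmetric]
  proof (split if_split, intro conjI impI)
    assume t: "i + q < d"
    show "r div d = i" "r mod d = i + q" using t d0 by (auto simp: r)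
    have "\<not> (a \<le> i + q + 1 \<and> q < b)" using \<open>i \<le> k\<close> k by linarith
    then show "Y_ent (i + q + 1) q \<in> free_entries n a b"
      using t n by (auto simp: free_entries_def)
  next
    assume t: "\<not> i + q < d"
    have "i < k" using last t \<open>i \<le> k\<close> k assms n by (cases "i = k") auto
    define e where "e = i + q - d"
    have e: "i + q = d + e" "e \<le> i" "e < d" using t q \<open>i < k\<close> k assms n by (auto simp: e_def)
    have "r = (i + 1) * d + e" using r e by simp
    then show "r div d = i + 1" "r mod d = i + q - d"
      using e d0 div_mult_self3[of d "i + 1" e] mod_mult_self3[of "i + 1" d e]
      unfolding e_def[symmetric] by (simp_all only: div_less mod_less add_0_right)
    show "X_ent (i + q - d + 1) q \<in> free_entries n a b"
      using e \<open>i < k\<close> k assms n q by (auto simp: free_entries_def)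
  qed
qed

lemma Suc_mod_less: "2 \<le> n \<Longrightarrow> r mod (n - 1) + 1 < n" for r n :: nat
  using mod_less_divisor[of "n - 1" r] by linarith

lemma core_entry_diagonal:
  assumes "a \<le> n" "b + 1 < a" "r < core_size n a b"
  shows "core n a b (generic_X n a b) (generic_Y n a b) $$ (r, r) = indet (core_entry n r r)"
proof -
  have "r mod n < n" "r mod (n - 1) + 1 < n"
    using assms Suc_mod_less[of n r] by auto
  then show ?thesis
    using core_diagonal[OF assms] assms(3)
    by (auto simp: core_def core_entry_def generic_X_def generic_Y_def split: if_splits)
qed

text \<open>The column of the variable gives \<open>r mod n\<close>; its kind and row then determine
  \<open>r div n\<close>.\<close>

lemma core_entry_inj:
  assumes "a \<le> n" "b + 1 < a"
  shows "inj_on (\<lambda>r. core_entry n r r) {0..<core_size n a b}"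
proof (rule inj_onI)
  fix r s assume rs: "r \<in> {0..<core_size n a b}" "s \<in> {0..<core_size n a b}"
    and eq: "core_entry n r r = core_entry n s s"
  have "r mod n = s mod n" and "r div n = s div n"
    using core_diagonal[OF assms, of r] core_diagonal[OF assms, of s] rs eq
    by (auto simp: core_entry_def split: if_splits; linarith)+
  then show "r = s" by (metis div_mult_mod_eq)
qed

lemma generic_core_index:
  assumes "2 \<le> n" "r < core_size n a b" "c < core_size n a b"
  defines "x \<equiv> core n a b (generic_X n a b) (generic_Y n a b) $$ (r, c)"
  shows "weigh_by w x = monom x (w (core_entry n r c))"
    "x \<noteq> 0 \<Longrightarrow> c div n = r div (n - 1) \<or> c div n + 1 = r div (n - 1)"
proof -
  have "c mod n < n" "r mod (n - 1) + 1 < n"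
    using assms(1) Suc_mod_less[of n r] by auto
  then show "weigh_by w x = monom x (w (core_entry n r c))"
    using assms(2,3)
    by (auto simp: x_def core_def core_entry_def generic_X_def generic_Y_def weigh_by_indet)
  show "x \<noteq> 0 \<Longrightarrow> c div n = r div (n - 1) \<or> c div n + 1 = r div (n - 1)"
    using assms(2,3) by (auto simp: x_def core_def split: if_splits)
qed

text \<open>Offsetting both indices by \<open>s\<close> changes their product only by row and column
  terms, so all trailing minors are covered: \<open>s = 0\<close> gives the squarefree leading form
  of \<open>phi\<close> at \<open>1\<close>, and \<open>s = n\<close> its nonvanishing at
  \<open>n + 1\<close>.\<close>

lemma lead_coeff_phi:
  assumes "a \<le> n" "b + 1 < a"
  shows "lead_coeff (weigh_by (entry_weight n) (phi n a b (generic_X n a b) (generic_Y n a b) (s + 1))) =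
    (\<Prod>i = 0..<core_size n a b - s. indet (core_entry n (i + s) (i + s)))"
proof -
  let ?N = "core_size n a b" and ?C = "core n a b (generic_X n a b) (generic_Y n a b)"
  define A where "A = mat (?N - s) (?N - s) (\<lambda>(i, j). ?C $$ (i + s, j + s))"
  have n2: "2 \<le> n" using assms by simp
  have C: "?C \<in> carrier_mat ?N ?N" by (simp add: core_def)
  obtain \<alpha> \<beta> :: "nat \<Rightarrow> int" where pot:
    "\<And>r c. c div n = r div (n - 1) \<or> c div n + 1 = r div (n - 1) \<Longrightarrow>
       2 * int (entry_weight n (core_entry n r c)) = 2 * (int r * int c) + \<alpha> r + \<beta> c"
    using core_entry_weight[OF n2] by blast
  have diag: "(\<Prod>i = 0..<?N - s. A $$ (i, i)) =
      (\<Prod>i = 0..<?N - s. indet (core_entry n (i + s) (i + s)))"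
    by (rule prod.cong) (use assms in \<open>auto simp: A_def core_entry_diagonal\<close>)
  have "lead_coeff (weigh_by (entry_weight n) (det A)) = (\<Prod>i = 0..<?N - s. A $$ (i, i))"
  proof (rule weigh_by_det)
    show "A \<in> carrier_mat (?N - s) (?N - s)" by (simp add: A_def)
    show "weigh_by (entry_weight n) (A $$ (i, j)) =
        monom (A $$ (i, j)) (entry_weight n (core_entry n (i + s) (j + s)))"
      if "i < ?N - s" "j < ?N - s" for i j
      using that generic_core_index(1)[OF n2, of "i + s" a b "j + s"] by (simp add: A_def)
    show "2 * int (entry_weight n (core_entry n (i + s) (j + s))) = 2 * (int i * int j) +
        (2 * int s * int i + 2 * int s * int s + \<alpha> (i + s)) + (2 * int s * int j + \<beta> (j + s))"
      if "i < ?N - s" "j < ?N - s" "A $$ (i, j) \<noteq> 0" for i j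
      using that pot[of "j + s" "i + s"] generic_core_index(2)[OF n2, of "i + s" a b "j + s"]
      by (simp add: A_def algebra_simps)
    show "(\<Prod>i = 0..<?N - s. A $$ (i, i)) \<noteq> 0"
      unfolding diag by (simp add: indet_nonzero)
  qed
  then show ?thesis
    unfolding diag by (simp add: phi_def submatrix_trailing[OF C] A_def)
qed

lemma phi_generic_nonzero:
  assumes "a \<le> n" "b + 1 < a"
  shows "phi n a b (generic_X n a b) (generic_Y n a b) (s + 1) \<noteq> 0"
proof
  assume "phi n a b (generic_X n a b) (generic_Y n a b) (s + 1) = 0"
  then have "(\<Prod>i = 0..<core_size n a b - s. indet (core_entry n (i + s) (i + s))) = 0"
    using lead_coeff_phi[OF assms, of s] by simp
  then show False by (simp add: indet_nonzero)
qed

lemma phi_1_dvd_of_dvd_square: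
  assumes "a \<le> n" "b + 1 < a"
    and "phi n a b (generic_X n a b) (generic_Y n a b) 1 dvd F * F"
  shows "phi n a b (generic_X n a b) (generic_Y n a b) 1 dvd F"
proof (rule dvd_of_dvd_square[OF _ _ assms(3)])
  let ?V = "(\<lambda>r. core_entry n r r) ` {0..<core_size n a b}"
  show "finite ?V" by simp
  show "lead_coeff (weigh_by (entry_weight n) (phi n a b (generic_X n a b) (generic_Y n a b) 1)) =
      (\<Prod>v\<in>?V. indet v)"
    using lead_coeff_phi[OF assms(1,2), of 0] by (simp add: prod.reindex[OF core_entry_inj[OF assms(1,2)]])
qed

section \<open>Reduction of the pencil\<close>

lemma det_diagonal:
  fixes f :: "nat \<Rightarrow> 'r :: comm_ring_1"
  shows "det (mat n n (\<lambda>(i, j). if i = j then f i else 0)) = (\<Prod>i = 0..<n. f i)"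
proof -
  have "det (mat n n (\<lambda>(i, j). if i = j then f i else 0)) =
      prod_list (diag_mat (mat n n (\<lambda>(i, j). if i = j then f i else 0)))"
    by (rule det_upper_triangular[of _ n]) (auto simp: upper_triangular_def)
  then show ?thesis by (simp add: prod_list_diag_prod)
qed

lemma diagonal_mult_left:
  fixes f :: "nat \<Rightarrow> 'r :: comm_ring_1"
  assumes "A \<in> carrier_mat n n" "i < n" "j < n"
  shows "(mat n n (\<lambda>(i, j). if i = j then f i else 0) * A) $$ (i, j) = f i * A $$ (i, j)"
proof -
  have "(mat n n (\<lambda>(i, j). if i = j then f i else 0) * A) $$ (i, j) =
      (\<Sum>m = 0..<n. (if i = m then f i else 0) * A $$ (m, j))"
    using assms by (simp add: scalar_prod_def)
  also have "\<dots> = (\<Sum>m = 0..<n. if m = i then f i * A $$ (i, j) else 0)"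
    by (rule sum.cong) auto
  finally show ?thesis using assms by simp
qed

lemma mult_diagonal_right:
  fixes f :: "nat \<Rightarrow> 'r :: comm_ring_1"
  assumes "A \<in> carrier_mat n n" "i < n" "j < n"
  shows "(A * mat n n (\<lambda>(i, j). if i = j then f i else 0)) $$ (i, j) = A $$ (i, j) * f j"
proof -
  have "(A * mat n n (\<lambda>(i, j). if i = j then f i else 0)) $$ (i, j) =
      (\<Sum>m = 0..<n. A $$ (i, m) * (if m = j then f m else 0))"
    using assms by (simp add: scalar_prod_def)
  also have "\<dots> = (\<Sum>m = 0..<n. if m = j then A $$ (i, j) * f j else 0)"
    by (rule sum.cong) auto
  finally show ?thesis using assms by simp
qed

text \<open>\<open>?L\<close> and \<open>?R\<close> restore the factor \<open>p\<close> of the last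
  rows and first columns, where \<open>X\<close> vanishes; where these overlap \<open>Y\<close>
  vanishes too, so the double factor does no harm.\<close>

lemma det_linear_combination:
  fixes X Y :: "'r :: comm_ring_1 mat"
  assumes X: "X_shape n a b X" and Y: "Y_shape n a b Y" and "b \<le> a" "a \<le> n"
  shows "det (p \<cdot>\<^sub>m Y + q \<cdot>\<^sub>m X) = p ^ (n - (a - b)) * det (reduced_pencil n a b X Y p q)"
proof -
  let ?L = "mat n n (\<lambda>(i, j). if i = j then (if i < a then 1 else p) else 0)"
  let ?R = "mat n n (\<lambda>(i, j). if i = j then (if i < b then p else 1) else 0)"
  let ?C = "reduced_pencil n a b X Y p q"
  have C: "?C \<in> carrier_mat n n" by (simp add: reduced_pencil_def)
  have "p \<cdot>\<^sub>m Y + q \<cdot>\<^sub>m X = ?L * (?C * ?R)"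
  proof (rule eq_matI)
    fix i j assume "i < dim_row (?L * (?C * ?R))" "j < dim_col (?L * (?C * ?R))"
    then have ij: "i < n" "j < n" by auto
    have "(?L * (?C * ?R)) $$ (i, j) =
        (if i < a then 1 else p) * (?C $$ (i, j) * (if j < b then p else 1))"
      using ij C by (simp only: diagonal_mult_left[of _ n] mult_diagonal_right[of _ n]
          mult_carrier_mat[of _ n n] mat_carrier)
    then show "(p \<cdot>\<^sub>m Y + q \<cdot>\<^sub>m X) $$ (i, j) = (?L * (?C * ?R)) $$ (i, j)"
      using ij X Y by (auto simp: reduced_pencil_def X_shape_def Y_shape_def)
  qed (use X Y in \<open>auto simp: X_shape_def Y_shape_def\<close>)
  then have "det (p \<cdot>\<^sub>m Y + q \<cdot>\<^sub>m X) = det ?L * (det ?C * det ?R)"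
    using C by (simp add: det_mult[of _ n] mult_carrier_mat[of _ n n])
  also have "det ?L = p ^ (n - a)"
  proof -
    have "(\<Prod>i = 0..<n. if i < a then 1 else p) = (\<Prod>i \<in> {a..<n}. p)"
      by (rule prod.mono_neutral_cong_right) auto
    then show ?thesis by (simp add: det_diagonal)
  qed
  also have "det ?R = p ^ b"
  proof -
    have "(\<Prod>i = 0..<n. if i < b then p else 1) = (\<Prod>i \<in> {0..<b}. p)"
      by (rule prod.mono_neutral_cong_right) (use assms in auto)
    then show ?thesis by (simp add: det_diagonal)
  qed
  also have "p ^ (n - a) * (det ?C * p ^ b) = p ^ ((n - a) + b) * det ?C"
    by (simp add: power_add mult_ac)
  also have "(n - a) + b = n - (a - b)"
    using assms(3,4) by simp
  finally show ?thesis .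
qed

lemma map_reduced_pencil:
  assumes "comm_ring_hom h" "X \<in> carrier_mat n n" "Y \<in> carrier_mat n n"
  shows "map_mat h (reduced_pencil n a b X Y p q) =
    reduced_pencil n a b (map_mat h X) (map_mat h Y) (h p) (h q)"
proof -
  interpret comm_ring_hom h by fact
  show ?thesis using assms(2,3)
    by (intro eq_matI) (auto simp: reduced_pencil_def hom_add hom_mult)
qed

text \<open>The power of \<open>lam\<close> is cancelled while \<open>lam\<close> is still an
  indeterminate; substituting \<open>p\<close> and \<open>q\<close> afterwards is then valid for all
  values.\<close>

lemma pencil_sum_eq_det:
  fixes X Y :: "'r :: idom mat"
  assumes X: "X_shape n a b X" and Y: "Y_shape n a b Y" and "b \<le> a" "a \<le> n"
    and c: "pencil_coeffs n (a - b) X Y c"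
  shows "(\<Sum>i=0..a - b. c i * q ^ i * p ^ (a - b - i)) = det (reduced_pencil n a b X Y p q)"
proof -
  let ?k = "a - b"
  let ?C = "reduced_pencil n a b (map_mat cnst X) (map_mat cnst Y) lam mu"
  have dims: "X \<in> carrier_mat n n" "Y \<in> carrier_mat n n"
    using X Y by (auto simp: X_shape_def Y_shape_def)
  have "X_shape n a b (map_mat cnst X)" "Y_shape n a b (map_mat cnst Y)"
    using X Y by (auto simp: X_shape_def Y_shape_def)
  then have "lam ^ (n - ?k) * det ?C = det (pencil X Y)"
    using assms(3,4) by (simp add: pencil_def det_linear_combination)
  also have "\<dots> = lam ^ (n - ?k) * (\<Sum>i=0..?k. cnst (c i) * mu ^ i * lam ^ (?k - i))"
    using c by (simp add: pencil_coeffs_def)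
  finally have eq: "det ?C = (\<Sum>i=0..?k. cnst (c i) * mu ^ i * lam ^ (?k - i))"
    by (simp add: lam_def)
  \<comment> \<open>The outer variable is \<open>mu\<close> and the inner one
    \<open>lam\<close>.\<close>
  define h :: "'r poly poly \<Rightarrow> 'r" where "h P = poly (poly P [:q:]) p" for P
  interpret h: comm_ring_hom h by standard (auto simp: h_def)
  have h: "h (cnst x) = x" "h lam = p" "h mu = q" for x
    by (auto simp: h_def cnst_def lam_def mu_def)
  have "map_mat h (map_mat cnst X) = X" "map_mat h (map_mat cnst Y) = Y"
    by (rule eq_matI; simp add: h)+
  then have "map_mat h ?C = reduced_pencil n a b X Y p q"
    using map_reduced_pencil[OF h.comm_ring_hom_axioms, of "map_mat cnst X" n "map_mat cnst Y"] dims
    by (simp add: h)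
  then have "det (reduced_pencil n a b X Y p q) = h (det ?C)"
    by (simp flip: h.hom_det)
  then show ?thesis unfolding eq by (simp add: h.hom_sum h.hom_mult h.hom_power h)
qed

section \<open>Compatibility of the minors with ring homomorphisms\<close>

lemma map_core:
  assumes "comm_ring_hom h" "X \<in> carrier_mat n n" "Y \<in> carrier_mat n n" "2 \<le> n"
  shows "map_mat h (core n a b X Y) = core n a b (map_mat h X) (map_mat h Y)"
proof -
  interpret comm_ring_hom h by fact
  have "c mod n < n" "r mod (n - 1) + 1 < n" for c r
    using assms(4) Suc_mod_less[of n r] by auto
  then show ?thesis using assms(2,3) by (intro eq_matI) (auto simp: core_def)
qed

lemma map_submatrix_trailing:
  assumes "A \<in> carrier_mat m m"
  shows "map_mat h (submatrix A {p..<m} {q..<m}) = submatrix (map_mat h A) {p..<m} {q..<m}"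
  using assms by (auto simp: submatrix_trailing[of _ m])

lemma hom_phi:
  assumes "comm_ring_hom h" "X \<in> carrier_mat n n" "Y \<in> carrier_mat n n" "2 \<le> n"
  shows "h (phi n a b X Y i) = phi n a b (map_mat h X) (map_mat h Y) i"
proof -
  interpret comm_ring_hom h by fact
  have "core n a b X Y \<in> carrier_mat (core_size n a b) (core_size n a b)"
    by (simp add: core_def)
  then show ?thesis using map_core[OF assms]
    by (simp add: phi_def map_submatrix_trailing flip: hom_det)
qed

lemma hom_det_Y_bar:
  assumes "comm_ring_hom h" "Y \<in> carrier_mat n n"
  shows "h (det (Y_bar n Y)) = det (Y_bar n (map_mat h Y))"
proof -
  interpret comm_ring_hom h by fact
  show ?thesis using assms(2) by (simp add: Y_bar_def map_submatrix_trailing flip: hom_det)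
qed

theorem theorem3p2:
  fixes n a b k :: nat and c :: "nat \<Rightarrow> entry_poly" and X Y :: "entry_poly mat"
  assumes "n \<ge> a" and "a > b + 1" and "k = a - b"
    and "X = generic_X n a b" and "Y = generic_Y n a b"
    and "pencil_coeffs n k X Y c"
  shows "\<exists>phi1_star. polynomial_in (free_entries n a b) phi1_star \<and>
    phi n a b X Y 1 * phi1_star =
      (\<Sum>i=0..k. c i * ((-1) ^ (n - 1) * det (Y_bar n Y) * phi n a b X Y (n + 1)) ^ i
                  * phi n a b X Y 2 ^ (k - i)) \<and>
    (\<forall>X0 Y0 :: complex mat. X_shape n a b X0 \<and> Y_shape n a b Y0 \<and> invertible_mat Y0 \<longrightarrow>
      phi n a b X0 Y0 1 * eval_at X0 Y0 phi1_star =
        (\<Sum>i=0..k. eval_at X0 Y0 (c i)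
                    * ((-1) ^ (n - 1) * det (Y_bar n Y0) * phi n a b X0 Y0 (n + 1)) ^ i
                    * phi n a b X0 Y0 2 ^ (k - i)))"
proof -
  let ?V = "free_entries n a b"
  define \<alpha> where "\<alpha> = (-1) ^ (n - 1) * det (Y_bar n Y) * phi n a b X Y (n + 1)"
  define F where "F = (\<Sum>i=0..k. c i * \<alpha> ^ i * phi n a b X Y 2 ^ (k - i))"
  have shapes: "X_shape n a b X" "Y_shape n a b Y"
    using assms(4,5) by (simp_all add: generic_X_shape generic_Y_shape)
  have dims: "X \<in> carrier_mat n n" "Y \<in> carrier_mat n n" and n2: "2 \<le> n"
    using shapes assms by (auto simp: X_shape_def Y_shape_def)
  interpret core: core_pencil n a b X Y
    by standard (use shapes assms in auto)
  have \<alpha>: "core.rho core.d = \<alpha>"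
    using core.rho_d unfolding core.phi_n1[symmetric] \<alpha>_def core.d_def .
  have F: "F = det (reduced_pencil n a b X Y (phi n a b X Y 2) \<alpha>)"
    using pencil_sum_eq_det[OF shapes, of c \<alpha> "phi n a b X Y 2"] assms by (simp add: F_def)
  have "phi n a b X Y (n + 1) \<noteq> 0"
    unfolding assms(4,5) by (rule phi_generic_nonzero) (use assms in auto)
  note dvd = core.phi_dvd[OF this, unfolded core.phi_2[symmetric] \<alpha>, folded F]
  have "phi n a b X Y 1 dvd F * F"
  proof -
    \<comment> \<open>The term \<open>i = 0\<close> contains \<open>phi\<close> at \<open>2\<close>
      because \<open>k > 0\<close>, all others contain \<alpha>; the second copy of \<open>F\<close>
      is the determinant in \<open>dvd\<close>.\<close>
    have "phi n a b X Y 1 dvd c i * \<alpha> ^ i * phi n a b X Y 2 ^ (k - i) * F" if "i \<le> k" for i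
    proof (cases i)
      case 0
      then obtain l where "k - i = Suc l" using assms by (cases "k - i") auto
      then show ?thesis using dvd_mult[OF dvd(1), of "c i * \<alpha> ^ i * phi n a b X Y 2 ^ l"]
        by (simp add: mult_ac)
    next
      case (Suc l)
      then show ?thesis using dvd_mult[OF dvd(2), of "c i * \<alpha> ^ l * phi n a b X Y 2 ^ (k - i)"]
        by (simp add: mult_ac)
    qed
    then have "phi n a b X Y 1 dvd (\<Sum>i=0..k. c i * \<alpha> ^ i * phi n a b X Y 2 ^ (k - i) * F)"
      by (intro dvd_sum) auto
    then show ?thesis by (subst F_def) (simp only: sum_distrib_right)
  qed
  then have "phi n a b X Y 1 dvd F"
    using phi_1_dvd_of_dvd_square[of a n b F] assms by simp
  then obtain g where g: "F = phi n a b X Y 1 * g" by (rule dvdE)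
  \<comment> \<open>The quotient \<open>g\<close> may a priori involve other variables; setting them
    to zero fixes \<open>F\<close> and \<open>phi\<close> at \<open>1\<close>, so the factorization
    survives.\<close>
  let ?g = "restrict_to ?V g"
  have fixed: "map_mat (restrict_to ?V) X = X" "map_mat (restrict_to ?V) Y = Y"
    unfolding assms(4,5)
    by (auto intro!: eq_matI simp: generic_X_def generic_Y_def restrict_to_indet)
  note hom_restrict = hom_phi[OF restrict_to_hom dims n2, of ?V, unfolded fixed]
  have "restrict_to ?V \<alpha> = \<alpha>"
    unfolding \<alpha>_def restrict.hom_mult restrict.hom_power restrict.hom_uminus restrict.hom_one
      hom_restrict hom_det_Y_bar[OF restrict_to_hom dims(2)] fixed ..
  then have "restrict_to ?V F = F"
    using map_reduced_pencil[OF restrict_to_hom dims, of ?V] unfolding F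
    by (simp add: fixed hom_restrict flip: restrict.hom_det)
  then have star: "phi n a b X Y 1 * ?g = F"
    unfolding g by (simp add: restrict.hom_mult hom_restrict)
  have "phi n a b X0 Y0 1 * eval_at X0 Y0 ?g =
      (\<Sum>i=0..k. eval_at X0 Y0 (c i)
        * ((-1) ^ (n - 1) * det (Y_bar n Y0) * phi n a b X0 Y0 (n + 1)) ^ i
        * phi n a b X0 Y0 2 ^ (k - i))"
    if "X_shape n a b X0" "Y_shape n a b Y0" for X0 Y0
  proof -
    have hom: "comm_ring_hom (eval_at X0 Y0)"
      unfolding eval_at_eq by (rule coefficient_hom.subst_poly_hom[OF coefficient_hom_id])
    interpret ev: comm_ring_hom "eval_at X0 Y0" by (rule hom)
    have "eval_at X0 Y0 (indet v) = entry_value X0 Y0 v" for v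
      unfolding eval_at_eq by (rule coefficient_hom.subst_poly_indet[OF coefficient_hom_id])
    \<comment> \<open>The shape conditions supply the values at the positions where the generic
      matrices are zero.\<close>
    then have specialize: "map_mat (eval_at X0 Y0) X = X0" "map_mat (eval_at X0 Y0) Y = Y0"
      using that unfolding assms(4,5)
      by (auto intro!: eq_matI simp: generic_X_def generic_Y_def free_entries_def entry_value_def
          X_shape_def Y_shape_def)
    have "phi n a b X0 Y0 1 * eval_at X0 Y0 ?g = eval_at X0 Y0 F"
      by (simp add: hom_phi[OF hom dims n2] specialize ev.hom_mult flip: star)
    then show ?thesis
      by (simp add: F_def \<alpha>_def ev.hom_sum ev.hom_mult ev.hom_power ev.hom_uminus
          hom_phi[OF hom dims n2] hom_det_Y_bar[OF hom dims(2)] specialize)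
  qed
  then show ?thesis
    using star polynomial_in_restrict_to[of ?V g] unfolding F_def \<alpha>_def by blast
qed

end
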